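(* Let $f\in L_1(G_m)$. Then $$\sigma_n^\psi f\to f\quad\text{almost everywhere on } G_m \text{ as } n\to\infty .$$
   Context: $\mathbb{N}_+$ is the set of positive integers and $\mathbb{N}=\mathbb{N}_+\cup\{0\}$. Let $m=(m_0,m_1,\dots)$ be a bounded sequence of integers, $m_k\ge 2$. $G_m$ is the complete direct product of the additive groups $Z_{m_k}=\{0,1,\dots,m_k-1\}$ of integers modulo $m_k$, with the product of the discrete topologies; its elements are sequences $x=(x_0,x_1,\dots)$ with $x_k\in Z_{m_k}$. $\mu$ is the normalized Haar measure on $G_m$ (the product of the uniform probability measures on $Z_{m_k}$); "almost everywhere" and $L_1(G_m)$ refer to $\mu$. Put $M_0=1$, $M_{k+1}=m_kM_k$; every $n\in\mathbb{N}$ is uniquely $n=\sum_{j\ge 0}n_jM_j$ with $n_j\in Z_{m_j}$, only finitely many $n_j$ nonzero. Generalized Rademacher functions: $r_k(x)=\exp(2\pi \imath x_k/m_k)$, $\imath^2=-1$. Vilenkin system: $\psi_n(x)=\prod_{k\ge 0}r_k(x)^{n_k}$, $n\in\mathbb{N}$. For $f\in L_1(G_m)$: $\widehat f^\psi(k)=\int_{G_m} f\,\overline{\psi_k}\,d\mu$ for $k\in\mathbb{N}$; $S_0^\psi f=0$ and $S_n^\psi f=\sum_{k=0}^{n-1}\widehat f^\psi(k)\psi_k$ for $n\in\mathbb{N}_+$; the Vilenkin–Fejér means are $\sigma_n^\psi f=\frac1n\sum_{k=0}^{n-1}S_k^\psi f$ for $n\in\mathbb{N}_+$. *)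

theory Defs
  imports "HOL-Probability.Probability"
begin

text \<open>
  The group \<open>G\<^sub>m\<close> is the space of sequences \<open>x\<close> with \<open>x k \<in> {0, \<dots>, m k - 1}\<close>. Its Borel
  \<open>\<sigma>\<close>-algebra is the countable product of the discrete ones, and its normalized Haar measure is the
  product of the uniform probability measures.
\<close>

definition vilenkin_measure :: "(nat \<Rightarrow> nat) \<Rightarrow> (nat \<Rightarrow> nat) measure" where
  "vilenkin_measure m = PiM UNIV (\<lambda>k. uniform_count_measure {..<m k})"

primrec gen_power :: "(nat \<Rightarrow> nat) \<Rightarrow> nat \<Rightarrow> nat" where
  "gen_power m 0 = 1"
| "gen_power m (Suc k) = m k * gen_power m k"

text \<open>
  The digits \<open>n\<^sub>j\<close> of \<open>n\<close> in the mixed-radix system with base \<open>m\<close> are given by a closed formula; the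
  lemmas below show that they are the unique coefficients of the expansion \<open>n = \<Sum>\<^sub>j n\<^sub>j M\<^sub>j\<close>.
\<close>

definition vdigit :: "(nat \<Rightarrow> nat) \<Rightarrow> nat \<Rightarrow> nat \<Rightarrow> nat" where
  "vdigit m n j = (n div gen_power m j) mod m j"

lemma less_gen_power:
  assumes "\<And>k. 2 \<le> m k"
  shows "k < gen_power m k"
proof (induction k)
  case (Suc k)
  have "2 * gen_power m k \<le> m k * gen_power m k"
    using assms by (intro mult_right_mono) auto
  then have "2 * gen_power m k \<le> gen_power m (Suc k)" by simp
  with Suc show ?case by linarith
qed simp

lemma vdigit_less:
  assumes "\<And>k. 2 \<le> m k"
  shows "vdigit m n j < m j"
  using assms[of j] by (simp add: vdigit_def)

lemma vdigit_eq_0: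
  assumes "\<And>k. 2 \<le> m k" "n \<le> j"
  shows "vdigit m n j = 0"
  using less_gen_power[of m j, OF assms(1)] assms(2) by (simp add: vdigit_def)

lemma vdigit_support:
  assumes "\<And>k. 2 \<le> m k"
  shows "{j. vdigit m n j \<noteq> 0} \<subseteq> {..<n}"
proof
  fix j assume "j \<in> {j. vdigit m n j \<noteq> 0}"
  then have "\<not> n \<le> j"
    using vdigit_eq_0[of m n j, OF assms] by auto
  then show "j \<in> {..<n}" by simp
qed

lemma finite_vdigit_support:
  assumes "\<And>k. 2 \<le> m k"
  shows "finite {j. vdigit m n j \<noteq> 0}"
  using finite_subset[OF vdigit_support[OF assms]] by simp

lemma vdigit_partial_expansion:
  "(\<Sum>j<k. vdigit m n j * gen_power m j) = n mod gen_power m k"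
proof (induction k)
  case (Suc k)
  have "n mod (gen_power m k * m k)
      = gen_power m k * (n div gen_power m k mod m k) + n mod gen_power m k"
    by (rule mod_mult2_eq)
  with Suc show ?case by (simp add: vdigit_def mult.commute)
qed simp

lemma vdigit_expansion:
  assumes "\<And>k. 2 \<le> m k"
  shows "n = (\<Sum>j | vdigit m n j \<noteq> 0. vdigit m n j * gen_power m j)"
proof -
  have "(\<Sum>j | vdigit m n j \<noteq> 0. vdigit m n j * gen_power m j)
      = (\<Sum>j<n. vdigit m n j * gen_power m j)"
    proof (rule sum.mono_neutral_left)
    show "{j. vdigit m n j \<noteq> 0} \<subseteq> {..<n}"
      by (rule vdigit_support[OF assms])
  qed auto
  also have "\<dots> = n"
    using less_gen_power[of m n, OF assms] by (simp add: vdigit_partial_expansion)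
  finally show ?thesis by simp
qed

lemma partial_expansion_less:
  assumes "\<And>j. d j < m j"
  shows "(\<Sum>j<k. d j * gen_power m j) < gen_power m k"
proof (induction k)
  case (Suc k)
  have "(\<Sum>j<Suc k. d j * gen_power m j) < Suc (d k) * gen_power m k"
    using Suc by simp
  also have "\<dots> \<le> m k * gen_power m k"
    using assms[of k] by (intro mult_right_mono) auto
  finally show ?case by simp
qed simp

lemma vdigit_unique:
  assumes m: "\<And>k. 2 \<le> m k" and d: "\<And>j. d j < m j" and fin: "finite {j. d j \<noteq> 0}"
    and n: "n = (\<Sum>j | d j \<noteq> 0. d j * gen_power m j)"
  shows "d = vdigit m n"
proof
  fix k
  obtain N where N: "{j. d j \<noteq> 0} \<subseteq> {..<N}"
    using fin finite_nat_iff_bounded by blast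
  define L where "L = max N (Suc k)"
  have nL: "n = (\<Sum>j<L. d j * gen_power m j)"
    unfolding n using N by (intro sum.mono_neutral_left) (auto simp: L_def)
  have dvd: "gen_power m (Suc k) dvd gen_power m j" if "Suc k \<le> j" for j
    using that by (induction rule: dec_induct) auto
  have split: "(\<Sum>j<L. d j * gen_power m j)
      = (\<Sum>j<Suc k. d j * gen_power m j) + (\<Sum>j=Suc k..<L. d j * gen_power m j)"
    by (simp only: lessThan_atLeast0, rule sum.atLeastLessThan_concat[symmetric]) (auto simp: L_def)
  have "gen_power m (Suc k) dvd (\<Sum>j=Suc k..<L. d j * gen_power m j)"
    by (intro dvd_sum dvd_mult dvd) auto
  then obtain c where c: "(\<Sum>j=Suc k..<L. d j * gen_power m j) = gen_power m (Suc k) * c"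
    by (elim dvdE)
  define s where "s = (\<Sum>j<k. d j * gen_power m j)"
  have s: "s < gen_power m k"
    unfolding s_def by (rule partial_expansion_less[OF d])
  have "n = s + gen_power m k * (d k + m k * c)"
    using nL split c by (simp add: s_def algebra_simps)
  then have "n div gen_power m k = d k + m k * c"
    using s by simp
  then show "d k = vdigit m n k"
    using d[of k] by (simp add: vdigit_def)
qed

definition rademacher :: "(nat \<Rightarrow> nat) \<Rightarrow> nat \<Rightarrow> (nat \<Rightarrow> nat) \<Rightarrow> complex" where
  "rademacher m k x = exp (2 * of_real pi * \<i> * of_nat (x k) / of_nat (m k))"

text \<open>
  All factors with \<open>n\<^sub>k = 0\<close> equal 1, so the infinite product reduces to the finite product over the
  support of the digits (see \<open>finite_vdigit_support\<close>).
\<close>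

definition vilenkin :: "(nat \<Rightarrow> nat) \<Rightarrow> nat \<Rightarrow> (nat \<Rightarrow> nat) \<Rightarrow> complex" where
  "vilenkin m n x = (\<Prod>k | vdigit m n k \<noteq> 0. rademacher m k x ^ vdigit m n k)"

definition vilenkin_coeff :: "(nat \<Rightarrow> nat) \<Rightarrow> ((nat \<Rightarrow> nat) \<Rightarrow> complex) \<Rightarrow> nat \<Rightarrow> complex" where
  "vilenkin_coeff m f k = (\<integral>x. f x * cnj (vilenkin m k x) \<partial>vilenkin_measure m)"

definition vilenkin_partial_sum ::
    "(nat \<Rightarrow> nat) \<Rightarrow> nat \<Rightarrow> ((nat \<Rightarrow> nat) \<Rightarrow> complex) \<Rightarrow> (nat \<Rightarrow> nat) \<Rightarrow> complex" where
  "vilenkin_partial_sum m n f x = (\<Sum>k<n. vilenkin_coeff m f k * vilenkin m k x)"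

definition vilenkin_fejer ::
    "(nat \<Rightarrow> nat) \<Rightarrow> nat \<Rightarrow> ((nat \<Rightarrow> nat) \<Rightarrow> complex) \<Rightarrow> (nat \<Rightarrow> nat) \<Rightarrow> complex" where
  "vilenkin_fejer m n f x = (\<Sum>k<n. vilenkin_partial_sum m k f x) / of_nat n"

end

theory Submission
  imports Defs
begin

text \<open>
  With \<open>u\<^sub>k = r\<^sub>k(x) / r\<^sub>k(y)\<close>, the Fejer kernel satisfies, for \<open>M\<^sub>N \<le> n < M\<^sub>N\<^sub>+\<^sub>1\<close>,
  \<open>n \<bar>K\<^sub>n(u)\<bar> \<le> C \<Sum>\<^sub>t\<^sub>\<le>\<^sub>L\<^sub>\<le>\<^sub>N M\<^sub>t M\<^sub>L\<close>, where only those \<open>t, L\<close> contribute for which \<open>u\<^sub>k = 1\<close> whenever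
  \<open>k < L\<close> and \<open>k \<noteq> t\<close>. Hence \<open>\<bar>\<sigma>\<^sub>n f(x)\<bar>\<close> is bounded by the means of \<open>\<bar>f\<bar>\<close> over the cylinders of
  level \<open>L\<close> at \<open>x\<close> with coordinate \<open>t\<close> left free, weighted by \<open>M\<^sub>t / M\<^sub>N\<close>. If such a mean is large,
  then \<open>x\<close> lies, up to its coordinate \<open>t\<close>, in a maximal cylinder on which the mean of \<open>\<bar>f\<bar>\<close> is
  large; when the level \<open>k\<close> of that cylinder exceeds \<open>t\<close>, then \<open>k - (L - t) \<le> t < k\<close>, so that
  there are at most \<open>L - t\<close> choices of \<open>t\<close>. Only this polynomial loss in \<open>L - t\<close> has to be beaten
  by the exponential decay of the weights, which gives the weak type (1,1) inequality for
  \<open>sup\<^sub>n \<bar>\<sigma>\<^sub>n f\<bar>\<close>. Almost everywhere convergence follows, since the Vilenkin polynomials are dense in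
  \<open>L\<^sub>1\<close>.
\<close>

locale bounded_radix =
  fixes m :: "nat \<Rightarrow> nat" and b :: nat
  assumes m_ge_2: "2 \<le> m k" and m_le: "m k \<le> b"
begin

abbreviation "M \<equiv> gen_power m"

section \<open>Mixed-radix arithmetic of the generalized powers\<close>

lemma M_pos: "0 < M k"
proof (induction k)
  case (Suc k)
  with m_ge_2[of k] show ?case by simp
qed simp

lemma b_ge_2: "2 \<le> b"
  using m_ge_2 m_le le_trans by blast

lemma M_dvd: "j \<le> k \<Longrightarrow> M j dvd M k"
  by (induction rule: dec_induct) auto

lemma M_mono: "j \<le> k \<Longrightarrow> M j \<le> M k"
  using M_dvd M_pos by (simp add: dvd_imp_le)

lemma vdigit_beyond: "n < M N \<Longrightarrow> N \<le> k \<Longrightarrow> vdigit m n k = 0"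
  using M_mono[of N k] by (simp add: vdigit_def)

text \<open>\<open>M (Suc k)\<close> divides \<open>M N\<close>, so the added multiple of
  \<open>M N\<close> shifts the quotient by \<open>M k\<close> only by a multiple of
  \<open>m k\<close>, which the digit does not see.\<close>

lemma vdigit_add_low:
  assumes "k < N"
  shows "vdigit m (a * M N + i) k = vdigit m i k"
proof -
  obtain c where "M N = M (Suc k) * c"
    using M_dvd[of "Suc k" N] assms by (auto elim: dvdE)
  then have "a * M N + i = i + M k * (m k * (a * c))"
    by (simp add: algebra_simps)
  then have "(a * M N + i) div M k = i div M k + m k * (a * c)"
    using M_pos[of k] by (simp only: div_mult_self2)
  then show ?thesis
    by (simp add: vdigit_def)
qed

lemma vdigit_add_top:
  assumes "i < M N" "a < m N"
  shows "vdigit m (a * M N + i) N = a"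
  using assms by (simp add: vdigit_def)

subsection \<open>The Fejer kernel\<close>

text \<open>The Vilenkin function expressed through an arbitrary sequence \<open>u\<close> of values
  of its Rademacher factors. Kernel identities are proved at this level; \<open>quot x y\<close> is
  substituted for \<open>u\<close> later.\<close>

definition chr :: "(nat \<Rightarrow> complex) \<Rightarrow> nat \<Rightarrow> complex" where
  "chr u n = (\<Prod>k | vdigit m n k \<noteq> 0. u k ^ vdigit m n k)"

lemma chr_eq_prod:
  assumes "n < M N"
  shows "chr u n = (\<Prod>k<N. u k ^ vdigit m n k)"
  unfolding chr_def
proof (rule prod.mono_neutral_left)
  show "{k. vdigit m n k \<noteq> 0} \<subseteq> {..<N}"
    using vdigit_beyond[OF assms] not_less by auto
qed auto

lemma chr_add:
  assumes "i < M N" "a < m N"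
  shows "chr u (a * M N + i) = u N ^ a * chr u i"
proof -
  have "a * M N + i < Suc a * M N"
    using assms(1) by simp
  also have "\<dots> \<le> m N * M N"
    using assms(2) by (intro mult_right_mono) auto
  finally have "a * M N + i < M (Suc N)" by simp
  then have "chr u (a * M N + i) = (\<Prod>k<Suc N. u k ^ vdigit m (a * M N + i) k)"
    by (rule chr_eq_prod)
  also have "\<dots> = (\<Prod>k<N. u k ^ vdigit m i k) * u N ^ a"
    using assms by (simp add: vdigit_add_low vdigit_add_top)
  finally show ?thesis
    using assms(1) by (simp add: chr_eq_prod)
qed

definition dirichlet :: "(nat \<Rightarrow> complex) \<Rightarrow> nat \<Rightarrow> complex" where
  "dirichlet u n = (\<Sum>j<n. chr u j)"

text \<open>This is \<open>n\<close> times the Fejer kernel.\<close>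

definition fejer_sum :: "(nat \<Rightarrow> complex) \<Rightarrow> nat \<Rightarrow> complex" where
  "fejer_sum u n = (\<Sum>k<n. dirichlet u k)"

lemma sum_lessThan_add:
  fixes f :: "nat \<Rightarrow> 'a :: comm_monoid_add"
  shows "(\<Sum>j<p + q. f j) = (\<Sum>j<p. f j) + (\<Sum>j<q. f (p + j))"
  by (induction q) (auto simp: add.assoc)

text \<open>The range splits into \<open>a\<close> blocks of length \<open>M N\<close>; by
  \<open>chr_add\<close>, block \<open>c\<close> repeats the first one up to the factor
  \<open>u N ^ c\<close>.\<close>

lemma dirichlet_block:
  assumes "a \<le> m N"
  shows "dirichlet u (a * M N) = (\<Sum>c<a. u N ^ c) * dirichlet u (M N)"
  using assms
proof (induction a)
  case (Suc a)
  have "dirichlet u (Suc a * M N)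
      = dirichlet u (a * M N) + (\<Sum>j<M N. chr u (a * M N + j))"
    by (simp add: dirichlet_def sum_lessThan_add flip: add.commute[of "a * M N"])
  also have "(\<Sum>j<M N. chr u (a * M N + j)) = u N ^ a * dirichlet u (M N)"
    using Suc.prems by (simp add: chr_add dirichlet_def sum_distrib_left)
  finally show ?case
    using Suc by (simp add: algebra_simps)
qed (simp add: dirichlet_def)

lemma dirichlet_add:
  assumes "a < m N" "i \<le> M N"
  shows "dirichlet u (a * M N + i)
    = (\<Sum>c<a. u N ^ c) * dirichlet u (M N) + u N ^ a * dirichlet u i"
proof -
  have "dirichlet u (a * M N + i) = dirichlet u (a * M N) + (\<Sum>j<i. chr u (a * M N + j))"
    by (simp add: dirichlet_def sum_lessThan_add)
  also have "(\<Sum>j<i. chr u (a * M N + j)) = u N ^ a * dirichlet u i"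
    using assms by (simp add: chr_add dirichlet_def sum_distrib_left)
  finally show ?thesis
    using assms by (simp add: dirichlet_block)
qed

lemma fejer_sum_add:
  assumes "a < m N" "r \<le> M N"
  shows "fejer_sum u (a * M N + r) = fejer_sum u (a * M N)
    + of_nat r * (\<Sum>c<a. u N ^ c) * dirichlet u (M N) + u N ^ a * fejer_sum u r"
proof -
  have "fejer_sum u (a * M N + r)
      = fejer_sum u (a * M N) + (\<Sum>i<r. dirichlet u (a * M N + i))"
    by (simp add: fejer_sum_def sum_lessThan_add)
  also have "(\<Sum>i<r. dirichlet u (a * M N + i))
      = (\<Sum>i<r. (\<Sum>c<a. u N ^ c) * dirichlet u (M N) + u N ^ a * dirichlet u i)"
    using assms by (intro sum.cong) (auto simp: dirichlet_add)
  finally show ?thesis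
    by (simp add: sum.distrib fejer_sum_def sum_distrib_left)
qed

text \<open>Block \<open>e\<close> starts from the Dirichlet sum accumulated over the
  \<open>e\<close> earlier blocks and carries it through \<open>M N\<close> terms, which produces
  the double sum. On top of that it repeats \<open>fejer_sum u (M N)\<close> with the factor
  \<open>u N ^ e\<close>.\<close>

lemma fejer_sum_block:
  assumes "a \<le> m N"
  shows "fejer_sum u (a * M N) = of_nat (M N) * (\<Sum>e<a. \<Sum>c<e. u N ^ c) * dirichlet u (M N)
    + (\<Sum>c<a. u N ^ c) * fejer_sum u (M N)"
  using assms
proof (induction a)
  case (Suc a)
  have "fejer_sum u (Suc a * M N) = fejer_sum u (a * M N + M N)"
    by (simp add: add.commute)
  also have "\<dots> = fejer_sum u (a * M N)
    + of_nat (M N) * (\<Sum>c<a. u N ^ c) * dirichlet u (M N) + u N ^ a * fejer_sum u (M N)"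
    using Suc.prems by (intro fejer_sum_add) auto
  finally show ?case
    using Suc by (simp add: algebra_simps)
qed (simp add: fejer_sum_def)

section \<open>Pointwise bounds for the Dirichlet and Fejer kernels\<close>

text \<open>An indicator, real-valued so that kernel bounds are linear combinations of it. For
  \<open>t\<close> \<ge> \<open>L\<close> no coordinate is exempt; \<open>agree u L L\<close> is the
  standard form of the full condition.\<close>

definition agree :: "(nat \<Rightarrow> complex) \<Rightarrow> nat \<Rightarrow> nat \<Rightarrow> real" where
  "agree u L t = of_bool (\<forall>k<L. k \<noteq> t \<longrightarrow> u k = 1)"

lemma agree_nonneg: "0 \<le> agree u L t"
  by (simp add: agree_def)

lemma sum_powers_root_of_unity:
  fixes u :: "nat \<Rightarrow> complex"
  assumes "u N ^ m N = 1"
  shows "(\<Sum>c<m N. u N ^ c) = (if u N = 1 then of_nat (m N) else 0)"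
  using assms one_diff_power_eq[of "u N" "m N"] by auto

text \<open>Paley's lemma. Passing from \<open>N\<close> to \<open>Suc N\<close> multiplies by the
  sum of all powers of the root of unity \<open>u N\<close>, which is \<open>m N\<close> if
  \<open>u N = 1\<close> and 0 otherwise.\<close>

lemma dirichlet_M:
  assumes "\<And>k. u k ^ m k = 1"
  shows "dirichlet u (M N) = of_real (M N * agree u N N)"
proof (induction N)
  case 0
  have "vdigit m 0 k = 0" for k by (simp add: vdigit_def)
  then show ?case by (simp add: dirichlet_def chr_def agree_def)
next
  case (Suc N)
  have "dirichlet u (M (Suc N)) = (\<Sum>c<m N. u N ^ c) * dirichlet u (M N)"
    using dirichlet_block[of "m N" N u] by simp
  moreover have "agree u (Suc N) (Suc N) = of_bool (u N = 1) * agree u N N"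
    by (auto simp: agree_def less_Suc_eq)
  ultimately show ?case
    using Suc sum_powers_root_of_unity[of u N, OF assms] by simp
qed

lemma norm_sum_powers_le:
  assumes "cmod z = 1"
  shows "cmod (\<Sum>c<a. z ^ c) \<le> a"
proof -
  have "cmod (\<Sum>c<a. z ^ c) \<le> (\<Sum>c<a. cmod (z ^ c))"
    by (rule norm_sum)
  with assms show ?thesis by (simp add: norm_power)
qed

lemma norm_sum_sum_powers_le:
  assumes "cmod z = 1"
  shows "cmod (\<Sum>e<a. \<Sum>c<e. z ^ c) \<le> real a * real a"
proof -
  have "cmod (\<Sum>e<a. \<Sum>c<e. z ^ c) \<le> (\<Sum>e<a. cmod (\<Sum>c<e. z ^ c))"
    by (rule norm_sum)
  also have "\<dots> \<le> (\<Sum>e<a. real a)"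
  proof (rule sum_mono)
    fix e assume "e \<in> {..<a}"
    then show "cmod (\<Sum>c<e. z ^ c) \<le> real a"
      using norm_sum_powers_le[OF assms, of e] by simp
  qed
  finally show ?thesis by simp
qed

lemma norm_root_of_unity:
  fixes u :: "nat \<Rightarrow> complex"
  assumes "u k ^ m k = 1"
  shows "cmod (u k) = 1"
proof -
  have "cmod (u k) ^ m k = 1 ^ m k"
    using assms by (simp flip: norm_power)
  then show ?thesis
    using m_ge_2[of k] power_eq_iff_eq_base[of "m k" "cmod (u k)" 1] by simp
qed

text \<open>From \<open>L\<close> to \<open>Suc L\<close>, the old kernel is multiplied by a full
  sum of powers of \<open>u L\<close>: it survives only if \<open>u L = 1\<close>, gains the factor
  \<open>m L\<close>, and keeps its free coordinates \<open>t\<close>. The Dirichlet part puts no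
  condition on \<open>u L\<close> and supplies the new term \<open>t = L\<close>.\<close>

lemma norm_fejer_sum_M_le:
  assumes u: "\<And>k. u k ^ m k = 1"
  shows "cmod (fejer_sum u (M L)) \<le> b\<^sup>2 * (\<Sum>t<L. real (M t) * real (M L) * agree u L t)"
proof (induction L)
  case 0
  show ?case by (simp add: fejer_sum_def dirichlet_def)
next
  case (Suc L)
  let ?q = "of_bool (u L = 1) :: real"
  note nu = norm_root_of_unity[of u, OF u]
  have "fejer_sum u (M (Suc L)) = of_nat (M L) * (\<Sum>e<m L. \<Sum>c<e. u L ^ c) * dirichlet u (M L)
    + (\<Sum>c<m L. u L ^ c) * fejer_sum u (M L)"
    using fejer_sum_block[of "m L" L u] by simp
  then have "cmod (fejer_sum u (M (Suc L)))
    \<le> cmod (of_nat (M L) * (\<Sum>e<m L. \<Sum>c<e. u L ^ c) * dirichlet u (M L))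
      + cmod ((\<Sum>c<m L. u L ^ c) * fejer_sum u (M L))"
    using norm_triangle_ineq by metis
  also have "cmod ((\<Sum>c<m L. u L ^ c) * fejer_sum u (M L)) = m L * ?q * cmod (fejer_sum u (M L))"
    using sum_powers_root_of_unity[of u L, OF u] by (simp add: norm_mult)
  also have "\<dots> \<le> m L * ?q * (b\<^sup>2 * (\<Sum>t<L. real (M t) * real (M L) * agree u L t))"
    using Suc.IH by (intro mult_left_mono) auto
  also have "\<dots> = b\<^sup>2 * (\<Sum>t<L. real (M t) * real (M (Suc L)) * agree u (Suc L) t)"
    unfolding sum_distrib_left
    by (intro sum.cong) (auto simp: agree_def less_Suc_eq)
  also have "cmod (of_nat (M L) * (\<Sum>e<m L. \<Sum>c<e. u L ^ c) * dirichlet u (M L))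
      = real (M L) * cmod (\<Sum>e<m L. \<Sum>c<e. u L ^ c) * (real (M L) * agree u L L)"
    using agree_nonneg[of u L L] by (simp add: dirichlet_M[OF u] norm_mult)
  also have "\<dots> \<le> real (M L) * (real (m L) * real (m L)) * (real (M L) * agree u L L)"
    using agree_nonneg[of u L L]
    by (intro mult_right_mono mult_left_mono norm_sum_sum_powers_le nu) auto
  \<comment> \<open>Coordinate \<open>L\<close> is exempt, so
    \<open>agree u (Suc L) L = agree u L L\<close>; one of the two factors \<open>m L\<close> turns
    \<open>M L\<close> into \<open>M (Suc L)\<close>.\<close>
  also have "\<dots> = m L * (real (M L) * real (M (Suc L)) * agree u (Suc L) L)"
    by (simp add: agree_def less_Suc_eq)
  also have "\<dots> \<le> b\<^sup>2 * (real (M L) * real (M (Suc L)) * agree u (Suc L) L)"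
  proof (rule mult_right_mono)
    have "m L * 1 \<le> b * b"
      using m_le[of L] b_ge_2 by (intro mult_mono) auto
    then show "real (m L) \<le> real (b\<^sup>2)"
      unfolding of_nat_le_iff by (simp add: power2_eq_square)
  qed (use agree_nonneg in auto)
  finally show ?case
    by (simp add: algebra_simps)
qed

text \<open>The leading digit \<open>a = n div M N\<close> is peeled off. The copies of
  \<open>fejer_sum u (M N)\<close> give the terms \<open>t < N\<close>, the Dirichlet contributions
  give \<open>t = N\<close>, and the remainder enters with a unimodular factor.\<close>

lemma norm_fejer_sum_step:
  assumes u: "\<And>k. u k ^ m k = 1" and n: "n < M (Suc N)"
  shows "cmod (fejer_sum u n) \<le> 2 * real b ^ 3 * (\<Sum>t\<le>N. real (M t) * real (M N) * agree u N t)
    + cmod (fejer_sum u (n mod M N))"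
proof -
  define a where "a = n div M N"
  define r where "r = n mod M N"
  have a: "a < m N"
    using n M_pos[of N] by (simp add: a_def less_mult_imp_div_less)
  then have ab: "real a \<le> real b"
    using m_le[of N] by simp
  have r: "r < M N"
    using M_pos[of N] by (simp add: r_def)
  have nar: "n = a * M N + r"
    unfolding a_def r_def by (rule div_mult_mod_eq[symmetric])
  define D where "D = real (M N) * agree u N N"
  have D: "cmod (dirichlet u (M N)) = D" "0 \<le> D"
    using agree_nonneg[of u N N] by (auto simp: dirichlet_M[OF u] D_def norm_mult)
  note nu = norm_root_of_unity[of u, OF u]
  have "fejer_sum u n = of_nat (M N) * (\<Sum>e<a. \<Sum>c<e. u N ^ c) * dirichlet u (M N)
    + (\<Sum>c<a. u N ^ c) * fejer_sum u (M N)
    + of_nat r * (\<Sum>c<a. u N ^ c) * dirichlet u (M N) + u N ^ a * fejer_sum u r"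
    unfolding nar using fejer_sum_add[OF a less_imp_le[OF r], of u] fejer_sum_block[of a N u] a by simp
  then have "cmod (fejer_sum u n)
    \<le> cmod (of_nat (M N) * (\<Sum>e<a. \<Sum>c<e. u N ^ c) * dirichlet u (M N))
      + cmod ((\<Sum>c<a. u N ^ c) * fejer_sum u (M N))
      + cmod (of_nat r * (\<Sum>c<a. u N ^ c) * dirichlet u (M N)) + cmod (u N ^ a * fejer_sum u r)"
    by (auto intro!: norm_triangle_le add_mono norm_triangle_ineq)
  also have "cmod (of_nat (M N) * (\<Sum>e<a. \<Sum>c<e. u N ^ c) * dirichlet u (M N))
      = real (M N) * cmod (\<Sum>e<a. \<Sum>c<e. u N ^ c) * D"
    by (simp add: norm_mult D)
  also have "\<dots> \<le> real (M N) * (real b * real b) * D"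
  proof (intro mult_right_mono mult_left_mono)
    have "real a * real a \<le> real b * real b"
      using ab by (intro mult_mono) auto
    with norm_sum_sum_powers_le[OF nu, of N a]
    show "cmod (\<Sum>e<a. \<Sum>c<e. u N ^ c) \<le> real b * real b" by linarith
  qed (use D in auto)
  also have "cmod ((\<Sum>c<a. u N ^ c) * fejer_sum u (M N))
      \<le> real b * ((real b)\<^sup>2 * (\<Sum>t<N. real (M t) * real (M N) * agree u N t))"
    unfolding norm_mult using norm_sum_powers_le[OF nu, of N a] ab norm_fejer_sum_M_le[OF u, of N]
    by (intro mult_mono) auto
  also have "cmod (of_nat r * (\<Sum>c<a. u N ^ c) * dirichlet u (M N))
      = real r * cmod (\<Sum>c<a. u N ^ c) * D"
    by (simp add: norm_mult D)
  also have "\<dots> \<le> real (M N) * real b * D"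
    using norm_sum_powers_le[OF nu, of N a] ab r D by (intro mult_right_mono mult_mono) auto
  also have "cmod (u N ^ a * fejer_sum u r) = cmod (fejer_sum u r)"
    using nu by (simp add: norm_mult norm_power)
  finally have "cmod (fejer_sum u n) \<le> (real b * real b + real b) * (real (M N) * D)
      + real b ^ 3 * (\<Sum>t<N. real (M t) * real (M N) * agree u N t) + cmod (fejer_sum u r)"
    by (simp add: algebra_simps power3_eq_cube power2_eq_square)
  \<comment> \<open>The Dirichlet contributions carry \<open>b * b\<close> from the full blocks and
    \<open>b\<close> from the incomplete one. The constant \<open>2 * b ^ 3\<close> absorbs both and
    also dominates the \<open>b ^ 3\<close> of the terms \<open>t < N\<close>.\<close>
  moreover have "(real b * real b + real b) * (real (M N) * D) \<le> 2 * real b ^ 3 * (real (M N) * D)"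
  proof (rule mult_right_mono)
    have b: "1 \<le> real b" using b_ge_2 by simp
    then have 1: "real b ^ 1 \<le> real b ^ 3"
      by (intro power_increasing) auto
    from b have 2: "real b ^ 2 \<le> real b ^ 3"
      by (intro power_increasing) auto
    show "real b * real b + real b \<le> 2 * real b ^ 3"
      using 1 2 unfolding power2_eq_square power_one_right by linarith
  qed (use D in auto)
  moreover have "real b ^ 3 * (\<Sum>t<N. real (M t) * real (M N) * agree u N t)
      \<le> 2 * real b ^ 3 * (\<Sum>t<N. real (M t) * real (M N) * agree u N t)"
    by (intro mult_right_mono sum_nonneg) (auto simp: agree_nonneg)
  ultimately show ?thesis
    by (simp add: lessThan_Suc_atMost[symmetric] D_def r_def algebra_simps)
qed

text \<open>The previous step is iterated down the digits of \<open>n\<close>; it ends at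
  \<open>N = 0\<close>, where the remainder modulo \<open>M 0 = 1\<close> is 0.\<close>

lemma norm_fejer_sum_le:
  assumes u: "\<And>k. u k ^ m k = 1" and "n < M (Suc N)"
  shows "cmod (fejer_sum u n)
    \<le> 2 * real b ^ 3 * (\<Sum>L\<le>N. \<Sum>t\<le>L. real (M t) * real (M L) * agree u L t)"
  using assms(2)
proof (induction N arbitrary: n)
  case 0
  then show ?case
    using norm_fejer_sum_step[OF u, of n 0] by (simp add: fejer_sum_def)
next
  case (Suc N)
  have "n mod M (Suc N) < M (Suc N)"
    using M_pos by (intro mod_less_divisor)
  then show ?case
    using Suc.IH[of "n mod M (Suc N)"] norm_fejer_sum_step[OF u Suc.prems]
    by (simp add: algebra_simps)
qed

subsection \<open>Cylinders and the integral representation\<close>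

abbreviation "\<mu> \<equiv> vilenkin_measure m"

sublocale coord: product_prob_space "\<lambda>k. uniform_count_measure {..<m k}" UNIV
proof (rule product_prob_spaceI)
  fix k
  have "{..<m k} \<noteq> {}"
    using m_ge_2[of k] by (auto simp: lessThan_empty_iff)
  then show "prob_space (uniform_count_measure {..<m k})"
    by (intro prob_space_uniform_count_measure) auto
qed

sublocale haar: prob_space "\<mu>"
  unfolding vilenkin_measure_def by (rule coord.prob_space_axioms)

lemma space_haar: "space \<mu> = {x. \<forall>k. x k < m k}"
  by (auto simp: vilenkin_measure_def space_PiM space_uniform_count_measure PiE_def Pi_def)

text \<open>The set counterpart of \<open>agree\<close>, with coordinate \<open>t\<close> left free.
  For \<open>t\<close> \<ge> \<open>L\<close> it is an ordinary cylinder, whose standard form is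
  \<open>cyl L L y\<close>.\<close>

definition cyl :: "nat \<Rightarrow> nat \<Rightarrow> (nat \<Rightarrow> nat) \<Rightarrow> (nat \<Rightarrow> nat) set" where
  "cyl L t y = {x \<in> space \<mu>. \<forall>k<L. k \<noteq> t \<longrightarrow> x k = y k}"

text \<open>Each factor carries the discrete sigma-algebra, on which every function is
  measurable.\<close>

lemma measurable_coord_comp [measurable]:
  fixes g :: "nat \<Rightarrow> 'a :: topological_space"
  shows "(\<lambda>x. g (x k)) \<in> borel_measurable \<mu>"
proof -
  have "(\<lambda>x. x k) \<in> \<mu> \<rightarrow>\<^sub>M uniform_count_measure {..<m k}"
    unfolding vilenkin_measure_def by (rule measurable_component_singleton) simp
  moreover have "g \<in> borel_measurable (uniform_count_measure {..<m k})"
    by (auto simp: measurable_def sets_uniform_count_measure space_uniform_count_measure)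
  ultimately show ?thesis
    by (rule measurable_compose)
qed

lemma emeasure_cyl:
  assumes "y \<in> space \<mu>"
  shows "emeasure \<mu> (cyl L t y) = (\<Prod>k\<in>{..<L} - {t}. ennreal (1 / m k))"
proof -
  have "cyl L t y = {x \<in> space \<mu>. \<forall>k\<in>{..<L} - {t}. x k \<in> {y k}}"
    by (auto simp: cyl_def)
  also have "emeasure \<mu> \<dots>
      = (\<Prod>k\<in>{..<L} - {t}. emeasure (uniform_count_measure {..<m k}) {y k})"
    unfolding vilenkin_measure_def using assms
    by (intro coord.emeasure_PiM_Collect) (auto simp: sets_uniform_count_measure space_haar)
  also have "\<dots> = (\<Prod>k\<in>{..<L} - {t}. ennreal (1 / m k))"
  proof (rule prod.cong)
    fix k assume "k \<in> {..<L} - {t}"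
    show "emeasure (uniform_count_measure {..<m k}) {y k} = ennreal (1 / m k)"
      using assms by (subst emeasure_uniform_count_measure) (auto simp: space_haar)
  qed simp
  finally show ?thesis .
qed

lemma sets_cyl [measurable]: "cyl L t y \<in> sets \<mu>"
proof -
  have "(\<lambda>x. of_bool (x k = y k) :: real) \<in> borel_measurable \<mu>" for k
    by (rule measurable_coord_comp)
  then have "{x \<in> space \<mu>. of_bool (x k = y k) = (1::real)} \<in> sets \<mu>" for k
    by measurable
  then have [measurable]: "Measurable.pred \<mu> (\<lambda>x. x k = y k)" for k
    by (simp add: pred_def)
  show ?thesis
    unfolding cyl_def by measurable
qed

lemma measure_cyl_prod:
  assumes "y \<in> space \<mu>"
  shows "measure \<mu> (cyl L t y) = (\<Prod>k\<in>{..<L} - {t}. 1 / m k)"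
  using emeasure_cyl[OF assms, of L t]
  by (simp add: measure_def prod_ennreal prod_nonneg)

lemma M_eq_prod: "M L = (\<Prod>k<L. m k)"
  by (induction L) auto

lemma measure_cyl:
  assumes "y \<in> space \<mu>"
  shows "measure \<mu> (cyl L L y) = 1 / M L"
proof -
  have "{..<L} - {L} = {..<L}" by auto
  then show ?thesis
    by (simp add: measure_cyl_prod[OF assms] M_eq_prod prod_dividef)
qed

text \<open>Freeing a coordinate \<open>t < L\<close> drops one factor \<open>1 / m t\<close> from
  the product, at a cost of at most \<open>b\<close>.\<close>

lemma measure_cyl_le:
  assumes "y \<in> space \<mu>"
  shows "measure \<mu> (cyl L t y) \<le> b / M L"
proof (cases "t < L")
  case True
  have "real (M L) = m t * (\<Prod>k\<in>{..<L} - {t}. real (m k))"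
    using True by (simp add: M_eq_prod prod.remove[of "{..<L}" t])
  moreover have "(\<Prod>k\<in>{..<L} - {t}. real (m k)) > 0"
    using m_ge_2 by (intro prod_pos) (metis of_nat_0_less_iff pos2 less_le_trans)
  moreover have "0 < m t" using m_ge_2[of t] by simp
  ultimately have "measure \<mu> (cyl L t y) = m t / M L"
    by (simp add: measure_cyl_prod[OF assms] prod_dividef field_simps)
  also have "\<dots> \<le> b / M L"
    using m_le[of t] by (intro divide_right_mono) auto
  finally show ?thesis .
next
  case False
  then have "cyl L t y = cyl L L y"
    by (auto simp: cyl_def)
  then show ?thesis
    using measure_cyl[OF assms, of L] b_ge_2 by (auto intro!: divide_right_mono)
qed

section \<open>Characters and the integral representation of the Fejer means\<close>

text \<open>The Rademacher value at the group difference of \<open>x\<close> and \<open>y\<close>: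
  conjugation inverts unimodular numbers, so subtraction in the group need not be
  formalised.\<close>

definition quot :: "(nat \<Rightarrow> nat) \<Rightarrow> (nat \<Rightarrow> nat) \<Rightarrow> nat \<Rightarrow> complex" where
  "quot x y k = rademacher m k x * cnj (rademacher m k y)"

lemma norm_rademacher: "cmod (rademacher m k x) = 1"
  by (simp add: rademacher_def)

lemma rademacher_power: "rademacher m k x ^ m k = 1"
proof -
  have "rademacher m k x ^ m k = exp (of_nat (m k) * (2 * of_real pi * \<i> * of_nat (x k) / of_nat (m k)))"
    by (simp only: rademacher_def exp_of_nat_mult)
  also have "of_nat (m k) * (2 * of_real pi * \<i> * of_nat (x k) / of_nat (m k))
      = (2 * of_real pi * \<i> * of_nat (x k) / of_nat 1 :: complex)"
    using m_ge_2[of k] by simp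
  also have "exp \<dots> = 1"
    using complex_root_unity_eq_1[of 1 "x k"] by simp
  finally show ?thesis .
qed

lemma quot_power: "quot x y k ^ m k = 1"
  by (simp add: quot_def power_mult_distrib rademacher_power flip: complex_cnj_power)

text \<open>Distinct residues give distinct roots of unity, and coordinates of points of the space
  are already reduced modulo \<open>m k\<close>.\<close>

lemma quot_eq_1_iff:
  assumes "x \<in> space \<mu>" "y \<in> space \<mu>"
  shows "quot x y k = 1 \<longleftrightarrow> x k = y k"
proof -
  let ?r = "\<lambda>x. rademacher m k x"
  have yy: "cnj (?r y) * ?r y = 1"
    using norm_rademacher[of k y] complex_norm_square[of "?r y"] by (simp add: mult.commute)
  have "quot x y k = 1 \<longleftrightarrow> ?r x = ?r y"
  proof
    assume "quot x y k = 1"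
    then have "?r x * (cnj (?r y) * ?r y) = ?r y"
      by (simp add: quot_def flip: mult.assoc)
    then show "?r x = ?r y" by (simp add: yy)
  next
    assume "?r x = ?r y"
    then show "quot x y k = 1" using yy by (simp add: quot_def mult.commute)
  qed
  also have "\<dots> \<longleftrightarrow> x k mod m k = y k mod m k"
    unfolding rademacher_def using m_ge_2[of k] by (intro complex_root_unity_eq) simp
  also have "\<dots> \<longleftrightarrow> x k = y k"
    using assms by (simp add: space_haar)
  finally show ?thesis .
qed

lemma chr_quot: "chr (quot x y) n = vilenkin m n x * cnj (vilenkin m n y)"
  by (simp add: chr_def quot_def vilenkin_def power_mult_distrib prod.distrib)

lemma agree_quot:
  assumes "x \<in> space \<mu>" "y \<in> space \<mu>"
  shows "agree (quot x y) L t = indicator (cyl L t x) y"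
  using assms by (auto simp: agree_def cyl_def quot_eq_1_iff indicator_def)

lemma norm_vilenkin: "cmod (vilenkin m n x) = 1"
  by (simp add: vilenkin_def norm_power norm_rademacher flip: prod_norm)

lemma vilenkin_measurable [measurable]: "vilenkin m n \<in> borel_measurable \<mu>"
  unfolding vilenkin_def rademacher_def by measurable

lemma integrable_mult_vilenkin:
  assumes "integrable \<mu> f"
  shows "integrable \<mu> (\<lambda>y. f y * cnj (vilenkin m n y))"
proof (rule Bochner_Integration.integrable_bound[OF assms])
  have [measurable]: "f \<in> borel_measurable \<mu>" using assms by auto
  have "cnj \<in> borel_measurable borel"
    by (intro borel_measurable_continuous_onI continuous_intros)
  then have "(\<lambda>y. cnj (vilenkin m n y)) \<in> borel_measurable \<mu>"
    by (rule measurable_compose[OF vilenkin_measurable])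
  then show "(\<lambda>y. f y * cnj (vilenkin m n y)) \<in> borel_measurable \<mu>" by measurable
qed (simp add: norm_mult norm_vilenkin)

lemma dirichlet_quot:
  "dirichlet (quot x y) n = (\<Sum>j<n. cnj (vilenkin m j y) * vilenkin m j x)"
  by (simp add: dirichlet_def chr_quot mult.commute)

lemma
  assumes "integrable \<mu> f"
  shows integrable_mult_dirichlet: "integrable \<mu> (\<lambda>y. f y * dirichlet (quot x y) n)"
    and partial_sum_eq_integral:
      "vilenkin_partial_sum m n f x = (\<integral>y. f y * dirichlet (quot x y) n \<partial>\<mu>)"
  unfolding dirichlet_quot vilenkin_partial_sum_def vilenkin_coeff_def sum_distrib_left mult.assoc[symmetric]
  using integrable_mult_vilenkin[OF assms] by (auto simp: Bochner_Integration.integral_sum)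

lemma
  assumes "integrable \<mu> f"
  shows integrable_mult_fejer_sum: "integrable \<mu> (\<lambda>y. f y * fejer_sum (quot x y) n)"
    and fejer_eq_integral:
      "vilenkin_fejer m n f x = (\<integral>y. f y * fejer_sum (quot x y) n \<partial>\<mu>) / of_nat n"
  unfolding fejer_sum_def vilenkin_fejer_def sum_distrib_left
  using integrable_mult_dirichlet[OF assms] partial_sum_eq_integral[OF assms]
  by (auto simp: Bochner_Integration.integral_sum)

text \<open>For \<open>t\<close> \<ge> \<open>L\<close> this is the true average of
  \<open>cmod (f y)\<close> over the cylinder. For \<open>t < L\<close> the cylinder has measure
  \<open>m t / M L\<close>, so the value is \<open>m t\<close> times the average.\<close>

definition mean :: "((nat \<Rightarrow> nat) \<Rightarrow> complex) \<Rightarrow> nat \<Rightarrow> nat \<Rightarrow> (nat \<Rightarrow> nat) \<Rightarrow> real" where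
  "mean f L t x = M L * (\<integral>y. cmod (f y) * indicator (cyl L t x) y \<partial>\<mu>)"

lemma integrable_norm_indicator:
  fixes f :: "(nat \<Rightarrow> nat) \<Rightarrow> complex"
  assumes "integrable \<mu> f" "A \<in> sets \<mu>"
  shows "integrable \<mu> (\<lambda>y. cmod (f y) * indicator A y)"
  using assms by (intro integrable_real_mult_indicator integrable_norm)

text \<open>The kernel bound is integrated against \<open>cmod (f y)\<close>, each
  \<open>agree\<close> becoming the indicator of a cylinder at \<open>x\<close>. The bound
  \<open>M N\<close> \<le> \<open>n\<close> lets \<open>1 / M N\<close> replace
  \<open>1 / n\<close>.\<close>

lemma norm_fejer_le:
  assumes f: "integrable \<mu> f" and x: "x \<in> space \<mu>" and n: "M N \<le> n" "n < M (Suc N)"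
  shows "cmod (vilenkin_fejer m n f x)
    \<le> 2 * real b ^ 3 / M N * (\<Sum>L\<le>N. \<Sum>t\<le>L. M t * mean f L t x)"
proof -
  let ?K = "2 * real b ^ 3"
  let ?g = "\<lambda>y. ?K * (\<Sum>L\<le>N. \<Sum>t\<le>L. M t * (M L * (cmod (f y) * indicator (cyl L t x) y)))"
  note int = integrable_norm_indicator[OF f sets_cyl]
  have "cmod (\<integral>y. f y * fejer_sum (quot x y) n \<partial>\<mu>)
      \<le> (\<integral>y. cmod (f y * fejer_sum (quot x y) n) \<partial>\<mu>)"
    by (rule integral_norm_bound)
  also have "\<dots> \<le> (\<integral>y. ?g y \<partial>\<mu>)"
  proof (rule integral_mono)
    show "integrable \<mu> (\<lambda>y. cmod (f y * fejer_sum (quot x y) n))"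
      by (intro integrable_norm integrable_mult_fejer_sum f)
    show "integrable \<mu> ?g"
      using int by (intro integrable_mult_right Bochner_Integration.integrable_sum) auto
    fix y assume y: "y \<in> space \<mu>"
    have "cmod (f y * fejer_sum (quot x y) n) \<le> cmod (f y) * (?K *
        (\<Sum>L\<le>N. \<Sum>t\<le>L. real (M t) * real (M L) * agree (quot x y) L t))"
      unfolding norm_mult using n by (intro mult_left_mono norm_fejer_sum_le quot_power) auto
    also have "\<dots> = ?g y"
      by (simp add: agree_quot[OF x y] sum_distrib_left algebra_simps)
    finally show "cmod (f y * fejer_sum (quot x y) n) \<le> ?g y" .
  qed
  also have "\<dots> = ?K * (\<Sum>L\<le>N. \<Sum>t\<le>L. M t * mean f L t x)"
    using int by (simp add: Bochner_Integration.integral_sum mean_def)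
  finally have *: "cmod (\<integral>y. f y * fejer_sum (quot x y) n \<partial>\<mu>)
      \<le> ?K * (\<Sum>L\<le>N. \<Sum>t\<le>L. M t * mean f L t x)" .
  have "cmod (vilenkin_fejer m n f x) = cmod (\<integral>y. f y * fejer_sum (quot x y) n \<partial>\<mu>) / n"
    by (simp add: fejer_eq_integral[OF f] norm_divide)
  also have "\<dots> \<le> (?K * (\<Sum>L\<le>N. \<Sum>t\<le>L. M t * mean f L t x)) / M N"
    using * n M_pos[of N] order_trans[OF norm_ge_zero *] by (intro frac_le) auto
  finally show ?thesis by simp
qed

subsection \<open>The weak type inequality\<close>

text \<open>The canonical representative of the level-\<open>k\<close> cylinder of \<open>x\<close>;
  filling up with zeros stays inside the space since every \<open>m j\<close> is positive.\<close>

definition trunc :: "nat \<Rightarrow> (nat \<Rightarrow> nat) \<Rightarrow> nat \<Rightarrow> nat" where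
  "trunc k x = (\<lambda>j. if j < k then x j else 0)"

definition reps :: "nat \<Rightarrow> (nat \<Rightarrow> nat) set" where
  "reps k = trunc k ` space \<mu>"

lemma reps_subset: "reps k \<subseteq> space \<mu>"
proof -
  have "0 < m j" for j
    using m_ge_2[of j] by simp
  then show ?thesis
    by (auto simp: reps_def trunc_def space_haar)
qed

lemma finite_reps: "finite (reps k)"
proof -
  have "reps k \<subseteq> trunc k ` (\<Pi>\<^sub>E j\<in>{..<k}. {..<m j})"
  proof
    fix y assume "y \<in> reps k"
    then obtain x where x: "x \<in> space \<mu>" "y = trunc k x"
      by (auto simp: reps_def)
    then have "y = trunc k (restrict x {..<k})"
      by (auto simp: trunc_def)
    moreover have "restrict x {..<k} \<in> (\<Pi>\<^sub>E j\<in>{..<k}. {..<m j})"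
      using x by (auto simp: space_haar)
    ultimately show "y \<in> trunc k ` (\<Pi>\<^sub>E j\<in>{..<k}. {..<m j})" by blast
  qed
  then show ?thesis
    by (rule finite_subset) (intro finite_imageI finite_PiE; simp)
qed

lemma trunc_mem_reps: "x \<in> space \<mu> \<Longrightarrow> trunc k x \<in> reps k"
  by (simp add: reps_def)

lemma mem_cyl_rep_iff:
  assumes "y \<in> reps k" "x \<in> space \<mu>"
  shows "x \<in> cyl k k y \<longleftrightarrow> y = trunc k x"
proof
  assume "x \<in> cyl k k y"
  then show "y = trunc k x"
    using assms(1) by (auto simp: cyl_def reps_def trunc_def fun_eq_iff)
qed (use assms(2) in \<open>auto simp: cyl_def trunc_def\<close>)

lemma disjoint_cyl_reps: "disjoint_family_on (cyl k k) (reps k)"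
proof -
  have "y = z" if "y \<in> reps k" "z \<in> reps k" "x \<in> cyl k k y" "x \<in> cyl k k z" for x y z
  proof -
    have "x \<in> space \<mu>" using that(3) by (simp add: cyl_def)
    with that show ?thesis by (metis mem_cyl_rep_iff)
  qed
  then show ?thesis
    unfolding disjoint_family_on_def by blast
qed

lemma cyl_cong: "(\<And>j. j < L \<Longrightarrow> j \<noteq> t \<Longrightarrow> x j = y j) \<Longrightarrow> cyl L t x = cyl L t y"
  by (auto simp: cyl_def)

lemma mean_cong: "(\<And>j. j < L \<Longrightarrow> j \<noteq> t \<Longrightarrow> x j = y j) \<Longrightarrow> mean f L t x = mean f L t y"
  using cyl_cong[of L t x y] by (simp add: mean_def)

text \<open>
  The Calderon--Zygmund stopping time at height \<open>l\<close>: representatives of the maximal cylinders on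
  which the mean of \<open>\<bar>f\<bar>\<close> exceeds \<open>l\<close>.
\<close>

definition stop :: "((nat \<Rightarrow> nat) \<Rightarrow> complex) \<Rightarrow> real \<Rightarrow> nat \<Rightarrow> (nat \<Rightarrow> nat) set" where
  "stop f l k = {y \<in> reps k. l < mean f k k y \<and> (\<forall>j<k. mean f j j y \<le> l)}"

definition stopped :: "((nat \<Rightarrow> nat) \<Rightarrow> complex) \<Rightarrow> real \<Rightarrow> nat \<Rightarrow> (nat \<Rightarrow> nat) set" where
  "stopped f l k = (\<Union>y\<in>stop f l k. cyl k k y)"

text \<open>The points that reach a maximal cylinder of level \<open>k\<close> after a suitable
  change of coordinate \<open>t\<close>. For \<open>t\<close> \<ge> \<open>k\<close> this is
  \<open>stopped f l k\<close> itself.\<close>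

definition smeared :: "((nat \<Rightarrow> nat) \<Rightarrow> complex) \<Rightarrow> real \<Rightarrow> nat \<Rightarrow> nat \<Rightarrow> (nat \<Rightarrow> nat) set" where
  "smeared f l k t = (\<Union>y\<in>stop f l k. cyl k t y)"

lemma stop_subset: "stop f l k \<subseteq> reps k"
  by (auto simp: stop_def)

lemma finite_stop: "finite (stop f l k)"
  using finite_subset[OF stop_subset finite_reps] .

lemma sets_stopped [measurable]: "stopped f l k \<in> sets \<mu>"
  unfolding stopped_def using finite_stop by (intro sets.finite_UN) auto

lemma sets_smeared [measurable]: "smeared f l k t \<in> sets \<mu>"
  unfolding smeared_def using finite_stop by (intro sets.finite_UN) auto

lemma stopped_mean:
  assumes "x \<in> stopped f l k"
  shows "l < mean f k k x" "j < k \<Longrightarrow> mean f j j x \<le> l"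
proof -
  obtain y where y: "y \<in> stop f l k" "x \<in> cyl k k y"
    using assms by (auto simp: stopped_def)
  have "mean f i i x = mean f i i y" if "i \<le> k" for i
    using y(2) that by (intro mean_cong) (auto simp: cyl_def)
  with y(1) show "l < mean f k k x" "j < k \<Longrightarrow> mean f j j x \<le> l"
    by (auto simp: stop_def)
qed

text \<open>The level at which a point is stopped is the first one whose mean exceeds
  \<open>l\<close>, hence unique.\<close>

lemma disjoint_stopped: "disjoint_family (stopped f l)"
proof -
  have "i = j" if "x \<in> stopped f l i" "x \<in> stopped f l j" for i j x
  proof (rule linorder_cases[of i j])
    assume "i < j"
    then show ?thesis
      using stopped_mean(1)[OF that(1)] stopped_mean(2)[OF that(2)] by (meson not_le)
  next
    assume "j < i"
    then show ?thesis
      using stopped_mean(1)[OF that(2)] stopped_mean(2)[OF that(1)] by (meson not_le)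
  qed
  then show ?thesis
    unfolding disjoint_family_on_def by blast
qed

text \<open>On a maximal cylinder the mean exceeds \<open>l\<close>, so its measure
  \<open>1 / M k\<close> is below \<open>1 / l\<close> times the integral of
  \<open>cmod (f z)\<close> over it; freeing \<open>t\<close> costs at most \<open>b\<close>.
  Cylinders of one level are disjoint, so the integrals add up.\<close>

lemma measure_smeared_le:
  assumes f: "integrable \<mu> f" and l: "0 < l"
  shows "measure \<mu> (smeared f l k t) \<le> b / l * (\<integral>y. cmod (f y) * indicator (stopped f l k) y \<partial>\<mu>)"
proof -
  note int = integrable_norm_indicator[OF f sets_cyl]
  have "measure \<mu> (smeared f l k t) \<le> (\<Sum>y\<in>stop f l k. measure \<mu> (cyl k t y))"
    unfolding smeared_def by (intro haar.finite_measure_subadditive_finite finite_stop) auto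
  also have "\<dots> \<le> (\<Sum>y\<in>stop f l k. b / l * (\<integral>z. cmod (f z) * indicator (cyl k k y) z \<partial>\<mu>))"
  proof (rule sum_mono)
    fix y assume y: "y \<in> stop f l k"
    then have "y \<in> space \<mu>" using stop_subset reps_subset by blast
    then have "measure \<mu> (cyl k t y) \<le> b / l * (l / M k)"
      using measure_cyl_le[of y k t] l by simp
    also have "\<dots> \<le> b / l * (\<integral>z. cmod (f z) * indicator (cyl k k y) z \<partial>\<mu>)"
      using y M_pos[of k] l by (intro mult_left_mono) (auto simp: stop_def mean_def field_simps)
    finally show "measure \<mu> (cyl k t y) \<le> b / l * (\<integral>z. cmod (f z) * indicator (cyl k k y) z \<partial>\<mu>)" .
  qed
  also have "\<dots> = b / l * (\<integral>z. (\<Sum>y\<in>stop f l k. cmod (f z) * indicator (cyl k k y) z) \<partial>\<mu>)"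
    using int by (simp add: Bochner_Integration.integral_sum sum_distrib_left)
  also have "(\<lambda>z. (\<Sum>y\<in>stop f l k. cmod (f z) * indicator (cyl k k y) z))
      = (\<lambda>z. cmod (f z) * indicator (stopped f l k) z)"
  proof
    fix z
    have "indicator (stopped f l k) z = (\<Sum>y\<in>stop f l k. indicator (cyl k k y) z :: real)"
      unfolding stopped_def
      by (rule indicator_UN_disjoint[OF finite_stop
            disjoint_family_on_mono[OF stop_subset disjoint_cyl_reps]])
    then show "(\<Sum>y\<in>stop f l k. cmod (f z) * indicator (cyl k k y) z)
        = cmod (f z) * indicator (stopped f l k) z"
      by (simp add: sum_distrib_left)
  qed
  finally show ?thesis .
qed

lemma sum_integral_stopped_le:
  assumes f: "integrable \<mu> f"
  shows "(\<Sum>k<K. \<integral>y. cmod (f y) * indicator (stopped f l k) y \<partial>\<mu>) \<le> (\<integral>y. cmod (f y) \<partial>\<mu>)"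
proof -
  note int = integrable_norm_indicator[OF f sets_stopped]
  have "(\<Sum>k<K. \<integral>y. cmod (f y) * indicator (stopped f l k) y \<partial>\<mu>)
      = (\<integral>y. (\<Sum>k<K. cmod (f y) * indicator (stopped f l k) y) \<partial>\<mu>)"
    by (rule Bochner_Integration.integral_sum[symmetric]) (rule int)
  also have "\<dots> \<le> (\<integral>y. cmod (f y) \<partial>\<mu>)"
  proof (rule integral_mono)
    fix y
    have "(\<Sum>k<K. indicator (stopped f l k) y) = (indicator (\<Union>k<K. stopped f l k) y :: real)"
      by (rule indicator_UN_disjoint[symmetric, OF finite_lessThan
            disjoint_family_on_mono[OF subset_UNIV disjoint_stopped]])
    also have "\<dots> \<le> 1" by (simp add: indicator_def)
    finally have "cmod (f y) * (\<Sum>k<K. indicator (stopped f l k) y) \<le> cmod (f y) * 1"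
      by (intro mult_left_mono) auto
    then show "(\<Sum>k<K. cmod (f y) * indicator (stopped f l k) y) \<le> cmod (f y)"
      by (simp add: sum_distrib_left)
  next
    show "integrable \<mu> (\<lambda>y. \<Sum>k<K. cmod (f y) * indicator (stopped f l k) y)"
      by (intro Bochner_Integration.integrable_sum int)
  qed (intro integrable_norm f)
  finally show ?thesis .
qed

section \<open>Exceptional sets and means with a free coordinate\<close>

text \<open>At level \<open>k\<close> the free coordinate runs through at most \<open>i + 1\<close>
  values ending at \<open>k\<close>, truncated subtraction cutting the window off at 0. The value
  \<open>t = k\<close> accounts for the maximal cylinders themselves.\<close>

definition exceptional :: "((nat \<Rightarrow> nat) \<Rightarrow> complex) \<Rightarrow> real \<Rightarrow> nat \<Rightarrow> (nat \<Rightarrow> nat) set" where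
  "exceptional f l i = (\<Union>k. \<Union>t\<in>{k - i..k}. smeared f l k t)"

lemma sets_exceptional [measurable]: "exceptional f l i \<in> sets \<mu>"
  unfolding exceptional_def by (intro sets.countable_UN sets.finite_UN) auto

text \<open>Each level contributes at most \<open>Suc i\<close> smeared sets, and disjointness of
  the stopped sets controls the sum over all levels.\<close>

lemma measure_exceptional_le:
  assumes f: "integrable \<mu> f" and l: "0 < l"
  shows "measure \<mu> (exceptional f l i) \<le> Suc i * (b / l * (\<integral>y. cmod (f y) \<partial>\<mu>))"
proof -
  let ?I = "\<lambda>k. \<integral>y. cmod (f y) * indicator (stopped f l k) y \<partial>\<mu>"
  let ?A = "\<lambda>k. \<Union>t\<in>{k - i..k}. smeared f l k t"
  let ?c = "\<lambda>k. Suc i * (b / l * ?I k)"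
  have I: "0 \<le> ?I k" for k
    by (intro Bochner_Integration.integral_nonneg) auto
  have A: "measure \<mu> (?A k) \<le> ?c k" for k
  proof -
    have "measure \<mu> (?A k) \<le> (\<Sum>t\<in>{k - i..k}. measure \<mu> (smeared f l k t))"
      by (intro haar.finite_measure_subadditive_finite) auto
    also have "\<dots> \<le> real (card {k - i..k}) * (b / l * ?I k)"
      by (intro sum_bounded_above measure_smeared_le f l)
    also have "\<dots> \<le> ?c k"
      using I l by (intro mult_right_mono) auto
    finally show ?thesis .
  qed
  have part: "(\<Sum>k<K. ?c k) \<le> Suc i * (b / l * (\<integral>y. cmod (f y) \<partial>\<mu>))" for K
    unfolding sum_distrib_left[symmetric]
    using l by (intro mult_left_mono sum_integral_stopped_le f) auto
  have c: "summable ?c"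
    using I l by (intro summableI_nonneg_bounded[OF _ part]) auto
  have sA: "summable (\<lambda>k. measure \<mu> (?A k))"
    by (rule summable_comparison_test'[OF c, of 0]) (use A in auto)
  have "measure \<mu> (\<Union>k. ?A k) \<le> (\<Sum>k. measure \<mu> (?A k))"
    by (intro haar.finite_measure_subadditive_countably sA) auto
  also have "\<dots> \<le> (\<Sum>k. ?c k)"
    by (intro suminf_le A sA c)
  also have "\<dots> \<le> Suc i * (b / l * (\<integral>y. cmod (f y) \<partial>\<mu>))"
    by (intro suminf_le_const c part)
  finally show ?thesis
    by (simp add: exceptional_def)
qed

text \<open>By contraposition: the cylinder with \<open>t\<close> free is a union of at most
  \<open>b\<close> ordinary cylinders, so one of these has mean above \<open>l\<close>. After a
  change at \<open>t\<close>, the point \<open>x\<close> thus lies in a maximal cylinder of some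
  level \<open>k\<close> \<le> \<open>t + i\<close>, which places \<open>x\<close> in a smeared
  set.\<close>

lemma mean_le_of_not_exceptional:
  assumes f: "integrable \<mu> f" and x: "x \<in> space \<mu>" and l: "0 \<le> l"
    and exc: "x \<notin> exceptional f l i"
  shows "mean f (t + i) t x \<le> real b * l"
proof (rule ccontr)
  define L where "L = t + i"
  assume "\<not> mean f (t + i) t x \<le> real b * l"
  then have big: "real b * l < mean f L t x"
    by (simp add: L_def)
  note int = integrable_norm_indicator[OF f sets_cyl]
  have upd: "x(t := s) \<in> space \<mu>" if "s < m t" for s
    using x that by (simp add: space_haar)
  have "\<exists>s<m t. l < mean f L L (x(t := s))"
  proof (rule ccontr)
    assume "\<not> ?thesis"
    then have small: "mean f L L (x(t := s)) \<le> l" if "s < m t" for s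
      using that by force
    have "mean f L t x \<le> M L * (\<integral>y. (\<Sum>s<m t. cmod (f y) * indicator (cyl L L (x(t := s))) y) \<partial>\<mu>)"
      unfolding mean_def
    proof (intro mult_left_mono integral_mono int Bochner_Integration.integrable_sum)
      fix y assume "y \<in> space \<mu>"
      then have y: "y t < m t" by (simp add: space_haar)
      have "indicator (cyl L t x) y \<le> (indicator (cyl L L (x(t := y t))) y :: real)"
        by (auto simp: cyl_def indicator_def)
      also have "\<dots> \<le> (\<Sum>s<m t. indicator (cyl L L (x(t := s))) y)"
        using y by (intro member_le_sum) auto
      finally have "cmod (f y) * indicator (cyl L t x) y
          \<le> cmod (f y) * (\<Sum>s<m t. indicator (cyl L L (x(t := s))) y)"
        by (intro mult_left_mono) auto
      then show "cmod (f y) * indicator (cyl L t x) y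
          \<le> (\<Sum>s<m t. cmod (f y) * indicator (cyl L L (x(t := s))) y)"
        by (simp add: sum_distrib_left)
    qed auto
    also have "\<dots> = (\<Sum>s<m t. mean f L L (x(t := s)))"
      unfolding mean_def by (subst Bochner_Integration.integral_sum) (rule int, rule sum_distrib_left)
    also have "\<dots> \<le> real (card {..<m t}) * l"
      using small by (intro sum_bounded_above) auto
    also have "\<dots> \<le> real b * l"
      using m_le[of t] l by (intro mult_right_mono) auto
    finally show False using big by simp
  qed
  then obtain s where s: "s < m t" "l < mean f L L (x(t := s))" by blast
  define x' where "x' = x(t := s)"
  \<comment> \<open>Taking the least level makes the cylinder around \<open>x'\<close>
    maximal.\<close>
  define k where "k = (LEAST k. l < mean f k k x')"
  have k: "l < mean f k k x'"
    using LeastI[of "\<lambda>k. l < mean f k k x'" L] s(2) by (simp add: k_def x'_def)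
  have "k \<le> L"
    unfolding k_def using s(2) by (intro Least_le) (simp add: x'_def)
  have below: "mean f j j x' \<le> l" if "j < k" for j
    using not_less_Least[of j "\<lambda>k. l < mean f k k x'"] that by (simp add: k_def)
  define y where "y = trunc k x'"
  have means: "mean f j j y = mean f j j x'" if "j \<le> k" for j
    using that by (intro mean_cong) (auto simp: y_def trunc_def)
  have y: "y \<in> stop f l k"
    using k below means upd[OF s(1)] by (auto simp: stop_def y_def x'_def intro: trunc_mem_reps)
  have xy: "x \<in> cyl k t y"
    using x by (auto simp: cyl_def y_def x'_def trunc_def)
  \<comment> \<open>If \<open>t < k\<close>, then \<open>k\<close> \<le> \<open>t + i\<close> puts
    \<open>t\<close> into the window. If \<open>k\<close> \<le> \<open>t\<close>, the change at
    \<open>t\<close> is invisible at level \<open>k\<close> and the index \<open>k\<close> serves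
    instead.\<close>
  have "x \<in> smeared f l k (min t k)"
  proof (cases "t < k")
    case False
    then have "cyl k t y = cyl k k y" by (auto simp: cyl_def)
    with False xy y show ?thesis by (auto simp: smeared_def min_def)
  qed (use xy y in \<open>auto simp: smeared_def min_def\<close>)
  moreover have "min t k \<in> {k - i..k}"
    using \<open>k \<le> L\<close> by (auto simp: L_def)
  ultimately show False
    using exc by (auto simp: exceptional_def)
qed

section \<open>Geometric sums and the weak type bound\<close>

lemma two_real_M_le: "2 * real (M k) \<le> real (M (Suc k))"
  using m_ge_2[of k] by (auto intro!: mult_right_mono)

lemma sum_M_le: "(\<Sum>L\<le>N. real (M L)) \<le> 2 * real (M N)"
proof (induction N)
  case (Suc N)
  have "2 * real (M N) \<le> real (M (Suc N))"
    by (rule two_real_M_le)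
  with Suc show ?case by simp
qed simp

text \<open>\<open>M\<close> at least doubles at each step, faster than the ratio 3/2. The constant
  4 reproduces itself in the induction: \<open>6 * M L + M (Suc L)\<close> \<le>
  \<open>4 * M (Suc L)\<close>.\<close>

lemma sum_M_power_le: "(\<Sum>t\<le>L. real (M t) * (3/2) ^ (L - t)) \<le> 4 * real (M L)"
proof (induction L)
  case (Suc L)
  have "(\<Sum>t\<le>L. real (M t) * (3/2) ^ (Suc L - t)) = 3/2 * (\<Sum>t\<le>L. real (M t) * (3/2) ^ (L - t))"
    unfolding sum_distrib_left by (intro sum.cong) (auto simp: Suc_diff_le)
  moreover have "2 * real (M L) \<le> real (M (Suc L))"
    by (rule two_real_M_le)
  ultimately show ?case using Suc by simp
qed simp

lemma exists_M_between:
  assumes "0 < n"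
  obtains N where "M N \<le> n" "n < M (Suc N)"
proof -
  define K where "K = (LEAST K. n < M K)"
  have K: "n < M K"
    unfolding K_def by (rule LeastI[of "\<lambda>K. n < M K" n]) (rule less_gen_power[OF m_ge_2])
  then have "K \<noteq> 0" using assms by (intro notI) simp
  then obtain N where N: "K = Suc N" using not0_implies_Suc by blast
  then have "\<not> n < M N"
    unfolding K_def by (intro not_less_Least) simp
  with K N show thesis by (intro that[of N]) auto
qed

text \<open>
  The heights \<open>l (3/2)\<^sup>i\<close> grow fast enough to compensate the factor \<open>i + 1\<close> in
  \<open>measure_exceptional_le\<close>, and slowly enough to be absorbed by the weights \<open>M t / M N\<close>.
\<close>

lemma weak_type_fejer:
  assumes f: "integrable \<mu> f" and l: "0 < l"
  obtains B where "B \<in> sets \<mu>" "measure \<mu> B \<le> 9 * b / l * (\<integral>y. cmod (f y) \<partial>\<mu>)"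
    "\<And>x n. x \<in> space \<mu> - B \<Longrightarrow> cmod (vilenkin_fejer m n f x) \<le> 16 * real b ^ 4 * l"
proof
  define E where "E i = exceptional f (l * (3/2) ^ i) i" for i
  define I where "I = (\<integral>y. cmod (f y) \<partial>\<mu>)"
  let ?c = "\<lambda>i. b / l * I * (real (Suc i) * (2/3) ^ i)"
  show "(\<Union>i. E i) \<in> sets \<mu>"
    unfolding E_def by measurable
  have E: "measure \<mu> (E i) \<le> ?c i" for i
    using measure_exceptional_le[OF f, of "l * (3/2) ^ i" i] l
    by (simp add: E_def I_def power_divide field_simps)
  \<comment> \<open>The differentiated geometric series at 2/3 has the value 9, the source of the
    constant in the measure bound.\<close>
  have "(\<lambda>i. real (Suc i) * (2/3) ^ i) sums (1 / (1 - 2/3)\<^sup>2)"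
    by (rule geometric_deriv_sums) simp
  then have "?c sums (b / l * I * (1 / (1 - 2/3)\<^sup>2))"
    by (rule sums_mult)
  moreover have "b / l * I * (1 / (1 - 2/3)\<^sup>2) = 9 * b / l * I"
    by (simp add: power2_eq_square)
  ultimately have c: "?c sums (9 * b / l * I)"
    by (simp only:)
  have sE: "summable (\<lambda>i. measure \<mu> (E i))"
    by (rule summable_comparison_test'[OF sums_summable[OF c], of 0]) (use E in auto)
  have "measure \<mu> (\<Union>i. E i) \<le> (\<Sum>i. measure \<mu> (E i))"
    by (intro haar.finite_measure_subadditive_countably sE) (auto simp: E_def)
  also have "\<dots> \<le> (\<Sum>i. ?c i)"
    by (intro suminf_le E sE sums_summable[OF c])
  finally show "measure \<mu> (\<Union>i. E i) \<le> 9 * b / l * (\<integral>y. cmod (f y) \<partial>\<mu>)"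
    using sums_unique[OF c] by (simp add: I_def)
  fix x n assume x: "x \<in> space \<mu> - (\<Union>i. E i)"
  show "cmod (vilenkin_fejer m n f x) \<le> 16 * real b ^ 4 * l"
  \<comment> \<open>For \<open>n = 0\<close> the Fejer mean is 0, and no \<open>N\<close> with
    \<open>M N\<close> \<le> \<open>n\<close> exists.\<close>
  proof (cases "n = 0")
    case True
    then show ?thesis using l by (simp add: vilenkin_fejer_def)
  next
    case False
    then obtain N where N: "M N \<le> n" "n < M (Suc N)"
      using exists_M_between by blast
    \<comment> \<open>The exceptional set of index \<open>L - t\<close> is the relevant one, so the
      height grows with the gap \<open>L - t\<close>.\<close>
    have mean: "mean f L t x \<le> b * (l * (3/2) ^ (L - t))" if "t \<le> L" for L t
      using mean_le_of_not_exceptional[OF f, of x "l * (3/2) ^ (L - t)" "L - t" t] x l that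
      by (auto simp: E_def)
    have "(\<Sum>L\<le>N. \<Sum>t\<le>L. M t * mean f L t x)
        \<le> (\<Sum>L\<le>N. \<Sum>t\<le>L. M t * (b * (l * (3/2) ^ (L - t))))"
      by (intro sum_mono mult_left_mono mean) auto
    also have "\<dots> = b * l * (\<Sum>L\<le>N. \<Sum>t\<le>L. real (M t) * (3/2) ^ (L - t))"
      by (simp add: sum_distrib_left algebra_simps)
    also have "\<dots> \<le> b * l * (\<Sum>L\<le>N. 4 * real (M L))"
      using l by (intro mult_left_mono sum_mono sum_M_power_le) auto
    \<comment> \<open>The 8 is the 4 of \<open>sum_M_power_le\<close> times the 2 of
      \<open>sum_M_le\<close>.\<close>
    also have "\<dots> \<le> b * l * (8 * M N)"
      using sum_M_le[of N] l by (intro mult_left_mono) (auto simp flip: sum_distrib_left)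
    finally have "2 * real b ^ 3 / M N * (\<Sum>L\<le>N. \<Sum>t\<le>L. M t * mean f L t x)
        \<le> 2 * real b ^ 3 / M N * (b * l * (8 * M N))"
      by (intro mult_left_mono) auto
    also have "\<dots> = 16 * real b ^ 4 * l"
      using M_pos[of N] by (simp add: power_numeral_reduce)
    finally show ?thesis
      using norm_fejer_le[OF f _ N] x by fastforce
  qed
qed

subsection \<open>Density of the Vilenkin polynomials\<close>

lemma integrable_indicator_complex:
  assumes "A \<in> sets \<mu>"
  shows "integrable \<mu> (indicator A :: _ \<Rightarrow> complex)"
proof -
  have "integrable \<mu> (\<lambda>x. complex_of_real (indicator A x))"
    using assms by (intro integrable_of_real integrable_real_indicator) (auto simp: less_top[symmetric])
  also have "(\<lambda>x. complex_of_real (indicator A x)) = indicator A"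
    by (auto simp: indicator_def)
  finally show ?thesis .
qed

text \<open>By Paley's lemma the partial sum of order \<open>M K\<close> averages over the
  level-\<open>K\<close> cylinder of \<open>x\<close>, on which the indicator of a coarser cylinder
  is constant.\<close>

lemma partial_sum_cyl:
  assumes x: "x \<in> space \<mu>" and K: "n \<le> K"
  shows "vilenkin_partial_sum m (M K) (indicator (cyl n n y)) x = indicator (cyl n n y) x"
proof -
  let ?g = "indicator (cyl n n y) :: _ \<Rightarrow> complex"
  have "vilenkin_partial_sum m (M K) ?g x = (\<integral>z. ?g z * dirichlet (quot x z) (M K) \<partial>\<mu>)"
    by (intro partial_sum_eq_integral integrable_indicator_complex sets_cyl)
  also have "\<dots> = (\<integral>z. ?g x * of_real (real (M K) * indicator (cyl K K x) z) \<partial>\<mu>)"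
  proof (rule Bochner_Integration.integral_cong)
    fix z assume z: "z \<in> space \<mu>"
    have "?g z * of_real (indicator (cyl K K x) z) = ?g x * of_real (indicator (cyl K K x) z)"
      using x z K by (auto simp: cyl_def indicator_def)
    then show "?g z * dirichlet (quot x z) (M K) = ?g x * of_real (real (M K) * indicator (cyl K K x) z)"
      by (simp add: dirichlet_M[OF quot_power] agree_quot[OF x z])
  qed simp
  also have "\<dots> = ?g x * of_real (M K * measure \<mu> (cyl K K x))"
    by simp
  also have "\<dots> = ?g x"
    using M_pos[of K] by (simp add: measure_cyl[OF x])
  finally show ?thesis .
qed

text \<open>Parseval: the partial sum of order \<open>M K\<close> equals the indicator, and
  integrating their product gives both sides. The point is that the right-hand side does not depend
  on \<open>K\<close>.\<close>

lemma sum_norm_coeff_cyl: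
  assumes K: "n \<le> K"
  shows "(\<Sum>j<M K. (cmod (vilenkin_coeff m (indicator (cyl n n y)) j))\<^sup>2) = measure \<mu> (cyl n n y)"
proof -
  let ?g = "indicator (cyl n n y) :: _ \<Rightarrow> complex"
  let ?c = "vilenkin_coeff m ?g"
  have g: "integrable \<mu> ?g"
    by (intro integrable_indicator_complex sets_cyl)
  have cg: "cnj (?g z) = ?g z" for z
    by (simp add: indicator_def)
  have cnj_c: "cnj (?c j) = (\<integral>z. ?g z * vilenkin m j z \<partial>\<mu>)" for j
    unfolding vilenkin_coeff_def
    by (simp add: cg flip: Bochner_Integration.integral_cnj)
  have int: "integrable \<mu> (\<lambda>z. ?c j * (?g z * vilenkin m j z))" for j
    using integrable_cnj[OF integrable_mult_vilenkin[OF g, of j]]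
    by (intro integrable_mult_right) (simp add: cg)
  have "complex_of_real (\<Sum>j<M K. (cmod (?c j))\<^sup>2) = (\<Sum>j<M K. ?c j * cnj (?c j))"
    by (simp only: of_real_sum complex_norm_square)
  also have "\<dots> = (\<Sum>j<M K. \<integral>z. ?c j * (?g z * vilenkin m j z) \<partial>\<mu>)"
    by (simp add: cnj_c)
  also have "\<dots> = (\<integral>z. (\<Sum>j<M K. ?c j * (?g z * vilenkin m j z)) \<partial>\<mu>)"
    by (rule Bochner_Integration.integral_sum[symmetric]) (rule int)
  also have "\<dots> = (\<integral>z. ?g z * vilenkin_partial_sum m (M K) ?g z \<partial>\<mu>)"
    by (simp add: vilenkin_partial_sum_def sum_distrib_left mult_ac)
  also have "\<dots> = (\<integral>z. of_real (indicator (cyl n n y) z) \<partial>\<mu>)"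
    by (intro Bochner_Integration.integral_cong) (auto simp: partial_sum_cyl[OF _ K] indicator_def)
  also have "\<dots> = of_real (measure \<mu> (cyl n n y))"
    by (subst integral_complex_of_real) simp
  finally show ?thesis
    by (simp only: of_real_eq_iff)
qed

text \<open>
  By Parseval the coefficients below \<open>M n\<close> already exhaust the \<open>L\<^sup>2\<close>-norm of the indicator.
\<close>

lemma coeff_cyl_eq_0:
  assumes j: "M n \<le> j"
  shows "vilenkin_coeff m (indicator (cyl n n y)) j = 0"
proof -
  let ?d = "\<lambda>j. (cmod (vilenkin_coeff m (indicator (cyl n n y)) j))\<^sup>2"
  have jK: "j < M (n + j)"
    using less_gen_power[of m j, OF m_ge_2] M_mono[of j "n + j"] by simp
  \<comment> \<open>The sums up to \<open>M n\<close> and up to \<open>M (n + j)\<close> have the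
    same value, while the second also contains the nonnegative term of index
    \<open>j\<close>.\<close>
  have "(\<Sum>i<M n. ?d i) + ?d j = (\<Sum>i\<in>insert j {..<M n}. ?d i)"
    using j by simp
  also have "\<dots> \<le> (\<Sum>i<M (n + j). ?d i)"
    using jK j by (intro sum_mono2) auto
  finally have "?d j \<le> 0"
    using sum_norm_coeff_cyl[of n n y] sum_norm_coeff_cyl[of n "n + j" y] by simp
  then show ?thesis by simp
qed

text \<open>The Vilenkin polynomials, characterised by their partial sums being eventually constant.\<close>

definition vilenkin_poly :: "((nat \<Rightarrow> nat) \<Rightarrow> complex) \<Rightarrow> bool" where
  "vilenkin_poly g \<longleftrightarrow> integrable \<mu> g \<and>
    (\<exists>N. \<forall>k\<ge>N. \<forall>x\<in>space \<mu>. vilenkin_partial_sum m k g x = g x)"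

lemma vilenkin_poly_cyl: "vilenkin_poly (indicator (cyl n n y))"
  unfolding vilenkin_poly_def
proof (intro conjI exI[of _ "M n"] allI impI ballI)
  let ?g = "indicator (cyl n n y) :: _ \<Rightarrow> complex"
  show "integrable \<mu> ?g"
    by (intro integrable_indicator_complex sets_cyl)
  fix k x assume k: "M n \<le> k" and x: "x \<in> space \<mu>"
  have "vilenkin_partial_sum m k ?g x = vilenkin_partial_sum m (M n) ?g x"
    unfolding vilenkin_partial_sum_def
    using k by (intro sum.mono_neutral_right) (auto simp: coeff_cyl_eq_0)
  then show "vilenkin_partial_sum m k ?g x = ?g x"
    using partial_sum_cyl[OF x, of n n] by simp
qed

lemma partial_sum_add:
  assumes "integrable \<mu> f" "integrable \<mu> g"
  shows "vilenkin_partial_sum m n (\<lambda>x. f x + g x) x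
    = vilenkin_partial_sum m n f x + vilenkin_partial_sum m n g x"
  using assms integrable_mult_dirichlet[OF assms(1), of x n] integrable_mult_dirichlet[OF assms(2), of x n]
  by (simp add: partial_sum_eq_integral distrib_right)

lemma partial_sum_mult:
  assumes "integrable \<mu> f"
  shows "vilenkin_partial_sum m n (\<lambda>x. c * f x) x = c * vilenkin_partial_sum m n f x"
  using assms by (simp add: partial_sum_eq_integral mult.assoc)

lemma fejer_add:
  assumes "integrable \<mu> f" "integrable \<mu> g"
  shows "vilenkin_fejer m n (\<lambda>x. f x + g x) x = vilenkin_fejer m n f x + vilenkin_fejer m n g x"
  by (simp add: vilenkin_fejer_def partial_sum_add[OF assms] sum.distrib add_divide_distrib)

lemma vilenkin_poly_add:
  assumes "vilenkin_poly f" "vilenkin_poly g"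
  shows "vilenkin_poly (\<lambda>x. f x + g x)"
proof -
  obtain N where N: "\<forall>k\<ge>N. \<forall>x\<in>space \<mu>. vilenkin_partial_sum m k f x = f x"
    using assms(1) by (auto simp: vilenkin_poly_def)
  obtain K where K: "\<forall>k\<ge>K. \<forall>x\<in>space \<mu>. vilenkin_partial_sum m k g x = g x"
    using assms(2) by (auto simp: vilenkin_poly_def)
  have "integrable \<mu> f" "integrable \<mu> g"
    using assms by (auto simp: vilenkin_poly_def)
  then show ?thesis
    unfolding vilenkin_poly_def using N K
    by (intro conjI exI[of _ "max N K"] allI impI ballI) (auto simp: partial_sum_add)
qed

lemma vilenkin_poly_mult:
  assumes "vilenkin_poly f"
  shows "vilenkin_poly (\<lambda>x. c * f x)"
  using assms by (auto simp: vilenkin_poly_def partial_sum_mult)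

lemma vilenkin_poly_sum:
  assumes "finite A" "\<And>a. a \<in> A \<Longrightarrow> vilenkin_poly (f a)"
  shows "vilenkin_poly (\<lambda>x. \<Sum>a\<in>A. f a x)"
  using assms
proof (induction A rule: finite_induct)
  case empty
  then show ?case
    by (simp add: vilenkin_poly_def vilenkin_partial_sum_def vilenkin_coeff_def)
qed (simp add: vilenkin_poly_add)

text \<open>Only finitely many partial sums differ from \<open>g x\<close>, so eventually the Fejer
  mean differs from \<open>g x\<close> by a fixed constant divided by \<open>n\<close>.\<close>

lemma fejer_tendsto_poly:
  assumes "vilenkin_poly g" and x: "x \<in> space \<mu>"
  shows "(\<lambda>n. vilenkin_fejer m n g x) \<longlonglongrightarrow> g x"
proof -
  obtain N where N: "\<And>k. N \<le> k \<Longrightarrow> vilenkin_partial_sum m k g x = g x"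
    using assms by (auto simp: vilenkin_poly_def)
  define C where "C = (\<Sum>k<N. vilenkin_partial_sum m k g x - g x)"
  have "(\<lambda>n. C / of_nat n + g x) \<longlonglongrightarrow> 0 + g x"
    by (intro tendsto_add tendsto_const lim_const_over_n)
  moreover have "\<forall>\<^sub>F n in sequentially. C / of_nat n + g x = vilenkin_fejer m n g x"
    using eventually_ge_at_top[of "max 1 N"]
  proof eventually_elim
    case (elim n)
    have "(\<Sum>k<n. vilenkin_partial_sum m k g x - g x) = C"
      unfolding C_def using elim N by (intro sum.mono_neutral_right) auto
    then have "(\<Sum>k<n. vilenkin_partial_sum m k g x) = C + of_nat n * g x"
      by (simp add: sum_subtractf algebra_simps)
    then show ?case
      using elim by (simp add: vilenkin_fejer_def add_divide_distrib)
  qed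
  ultimately show ?thesis
    by (simp add: tendsto_cong)
qed

section \<open>Approximation in L1 by Vilenkin polynomials\<close>

text \<open>Membership in the L1-closure of the polynomials, meant for integrable \<open>f\<close>:
  Bochner integrals of non-integrable functions default to 0, so \<open>approximable_add\<close> and
  \<open>approximable_limit\<close> assume integrability separately.\<close>

definition approximable :: "((nat \<Rightarrow> nat) \<Rightarrow> complex) \<Rightarrow> bool" where
  "approximable f \<longleftrightarrow> (\<forall>e>0. \<exists>g. vilenkin_poly g \<and> (\<integral>x. cmod (f x - g x) \<partial>\<mu>) < e)"

lemma approximable_poly: "vilenkin_poly f \<Longrightarrow> approximable f"
  unfolding approximable_def by (intro allI impI exI[of _ f]) auto

lemma approximable_cong:
  assumes "approximable f" "\<And>x. x \<in> space \<mu> \<Longrightarrow> f x = g x"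
  shows "approximable g"
proof -
  have "(\<integral>x. cmod (f x - h x) \<partial>\<mu>) = (\<integral>x. cmod (g x - h x) \<partial>\<mu>)" for h
    using assms(2) by (intro Bochner_Integration.integral_cong) auto
  with assms(1) show ?thesis by (simp add: approximable_def)
qed

lemma integrable_norm_diff_poly:
  assumes "integrable \<mu> f" "vilenkin_poly g"
  shows "integrable \<mu> (\<lambda>x. cmod (f x - g x))"
  using assms by (intro integrable_norm Bochner_Integration.integrable_diff) (auto simp: vilenkin_poly_def)

lemma approximable_add:
  assumes "integrable \<mu> f" "approximable f" "integrable \<mu> g" "approximable g"
  shows "approximable (\<lambda>x. f x + g x)"
  unfolding approximable_def
proof (intro allI impI)
  fix e :: real assume "0 < e"
  then obtain p q where p: "vilenkin_poly p" "(\<integral>x. cmod (f x - p x) \<partial>\<mu>) < e / 2"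
    and q: "vilenkin_poly q" "(\<integral>x. cmod (g x - q x) \<partial>\<mu>) < e / 2"
    using assms(2,4) unfolding approximable_def by (meson half_gt_zero)
  note pq = integrable_norm_diff_poly[OF assms(1) p(1)] integrable_norm_diff_poly[OF assms(3) q(1)]
  have "(\<integral>x. cmod (f x + g x - (p x + q x)) \<partial>\<mu>) \<le> (\<integral>x. cmod (f x - p x) + cmod (g x - q x) \<partial>\<mu>)"
  proof (rule integral_mono)
    show "integrable \<mu> (\<lambda>x. cmod (f x + g x - (p x + q x)))"
      using assms by (intro integrable_norm_diff_poly vilenkin_poly_add p q) auto
    show "integrable \<mu> (\<lambda>x. cmod (f x - p x) + cmod (g x - q x))"
      using pq by (rule Bochner_Integration.integrable_add)
    show "cmod (f x + g x - (p x + q x)) \<le> cmod (f x - p x) + cmod (g x - q x)" for x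
      by (rule norm_diff_triangle_ineq)
  qed
  also have "\<dots> < e"
    using p q pq by simp
  finally show "\<exists>r. vilenkin_poly r \<and> (\<integral>x. cmod (f x + g x - r x) \<partial>\<mu>) < e"
    using vilenkin_poly_add[OF p(1) q(1)] by blast
qed

lemma approximable_mult:
  assumes "approximable f"
  shows "approximable (\<lambda>x. c * f x)"
  unfolding approximable_def
proof (intro allI impI)
  fix e :: real assume e: "0 < e"
  \<comment> \<open>Adding 1 keeps the denominator positive for \<open>c = 0\<close> and makes the
    final inequality strict.\<close>
  define d where "d = e / (cmod c + 1)"
  have c: "0 < cmod c + 1"
    by (simp add: add_nonneg_pos)
  then have "0 < d" using e by (simp add: d_def)
  then obtain p where p: "vilenkin_poly p" "(\<integral>x. cmod (f x - p x) \<partial>\<mu>) < d"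
    using assms unfolding approximable_def by blast
  have "(\<integral>x. cmod (c * f x - c * p x) \<partial>\<mu>) = cmod c * (\<integral>x. cmod (f x - p x) \<partial>\<mu>)"
    by (simp add: norm_mult flip: right_diff_distrib)
  also have "\<dots> \<le> cmod c * d"
    using p by (intro mult_left_mono) auto
  also have "\<dots> < e"
    using c e by (simp add: d_def field_simps)
  finally show "\<exists>r. vilenkin_poly r \<and> (\<integral>x. cmod (c * f x - r x) \<partial>\<mu>) < e"
    using vilenkin_poly_mult[OF p(1), of c] by blast
qed

text \<open>Dominated convergence with majorant \<open>3 * cmod (f x)\<close>, then the triangle
  inequality. The factor 2 in the bound is the one that \<open>integrable_induct\<close>
  supplies.\<close>

lemma approximable_limit:
  assumes s: "\<And>i. integrable \<mu> (s i)" "\<And>i. approximable (s i)" and f: "integrable \<mu> f"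
    and lim: "\<And>x. x \<in> space \<mu> \<Longrightarrow> (\<lambda>i. s i x) \<longlonglongrightarrow> f x"
    and bound: "\<And>i x. x \<in> space \<mu> \<Longrightarrow> cmod (s i x) \<le> 2 * cmod (f x)"
  shows "approximable f"
  unfolding approximable_def
proof (intro allI impI)
  fix e :: real assume e: "0 < e"
  have fm: "f \<in> borel_measurable \<mu>" and sm: "\<And>i. s i \<in> borel_measurable \<mu>"
    using s f by auto
  have "(\<lambda>i. \<integral>x. cmod (f x - s i x) \<partial>\<mu>) \<longlonglongrightarrow> (\<integral>x. 0 \<partial>\<mu>)"
  proof (rule integral_dominated_convergence[where w = "\<lambda>x. 3 * cmod (f x)"])
    show "integrable \<mu> (\<lambda>x. 3 * cmod (f x))" using f by simp
    show "AE x in \<mu>. (\<lambda>i. cmod (f x - s i x)) \<longlonglongrightarrow> 0"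
    proof (rule AE_I2)
      fix x assume "x \<in> space \<mu>"
      then have "(\<lambda>i. cmod (f x - s i x)) \<longlonglongrightarrow> cmod (f x - f x)"
        by (intro tendsto_norm tendsto_diff tendsto_const lim)
      then show "(\<lambda>i. cmod (f x - s i x)) \<longlonglongrightarrow> 0" by simp
    qed
    show "AE x in \<mu>. norm (cmod (f x - s i x)) \<le> 3 * cmod (f x)" for i
    proof (rule AE_I2)
      fix x assume "x \<in> space \<mu>"
      then show "norm (cmod (f x - s i x)) \<le> 3 * cmod (f x)"
        using bound[of x i] norm_triangle_ineq4[of "f x" "s i x"] by simp
    qed
  qed (use fm sm in measurable)
  then have "\<forall>\<^sub>F i in sequentially. (\<integral>x. cmod (f x - s i x) \<partial>\<mu>) < e / 2"
    using e by (intro order_tendstoD) auto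
  then obtain i where i: "(\<integral>x. cmod (f x - s i x) \<partial>\<mu>) < e / 2"
    using eventually_happens sequentially_bot by blast
  obtain p where p: "vilenkin_poly p" "(\<integral>x. cmod (s i x - p x) \<partial>\<mu>) < e / 2"
    using s(2)[of i] e unfolding approximable_def by (meson half_gt_zero)
  have 1: "integrable \<mu> (\<lambda>x. cmod (f x - s i x))"
    using f s by auto
  note 2 = integrable_norm_diff_poly[OF s(1) p(1), of i]
  have "(\<integral>x. cmod (f x - p x) \<partial>\<mu>) \<le> (\<integral>x. cmod (f x - s i x) + cmod (s i x - p x) \<partial>\<mu>)"
  proof (rule integral_mono)
    show "integrable \<mu> (\<lambda>x. cmod (f x - p x))"
      by (intro integrable_norm_diff_poly f p)
    show "integrable \<mu> (\<lambda>x. cmod (f x - s i x) + cmod (s i x - p x))"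
      using 1 2 by (rule Bochner_Integration.integrable_add)
    show "cmod (f x - p x) \<le> cmod (f x - s i x) + cmod (s i x - p x)" for x
      using norm_triangle_ineq[of "f x - s i x" "s i x - p x"] by simp
  qed
  also have "\<dots> < e"
    using i p 1 2 by simp
  finally show "\<exists>r. vilenkin_poly r \<and> (\<integral>x. cmod (f x - r x) \<partial>\<mu>) < e"
    using p(1) by blast
qed

text \<open>A set determined by the first \<open>n\<close> coordinates is the finite disjoint union
  of the level-\<open>n\<close> cylinders of the representatives it contains.\<close>

lemma vilenkin_poly_finite_dependence:
  assumes A: "A \<subseteq> space \<mu>"
    and dep: "\<And>x z. x \<in> A \<Longrightarrow> z \<in> space \<mu> \<Longrightarrow> (\<And>k. k < n \<Longrightarrow> z k = x k) \<Longrightarrow> z \<in> A"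
  shows "vilenkin_poly (indicator A)"
proof -
  have "A = (\<Union>y\<in>reps n \<inter> A. cyl n n y)"
  proof
    show "(\<Union>y\<in>reps n \<inter> A. cyl n n y) \<subseteq> A"
      using dep by (auto simp: cyl_def)
    show "A \<subseteq> (\<Union>y\<in>reps n \<inter> A. cyl n n y)"
    proof
      fix x assume x: "x \<in> A"
      then have "x \<in> space \<mu>" using A by blast
      moreover from this have r: "trunc n x \<in> reps n" by (rule trunc_mem_reps)
      moreover have "trunc n x \<in> A"
        using x r reps_subset by (intro dep[OF x]) (auto simp: trunc_def)
      ultimately show "x \<in> (\<Union>y\<in>reps n \<inter> A. cyl n n y)"
        by (auto simp: mem_cyl_rep_iff)
    qed
  qed
  moreover have "indicator (\<Union>y\<in>reps n \<inter> A. cyl n n y) x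
      = (\<Sum>y\<in>reps n \<inter> A. indicator (cyl n n y) x :: complex)" for x
    by (rule indicator_UN_disjoint[OF finite_Int[OF disjI1[OF finite_reps]]
          disjoint_family_on_mono[OF Int_lower1 disjoint_cyl_reps]])
  ultimately have "indicator A = (\<lambda>x. \<Sum>y\<in>reps n \<inter> A. indicator (cyl n n y) x :: complex)"
    by auto
  then show ?thesis
    using finite_reps by (auto intro!: vilenkin_poly_sum vilenkin_poly_cyl)
qed

text \<open>Dynkin's argument over an intersection-stable generator: generators depend on finitely
  many coordinates, complements follow by linearity, and countable disjoint unions are limits of
  finite ones.\<close>

lemma approximable_indicator:
  assumes "A \<in> sets \<mu>"
  shows "approximable (indicator A)"
proof -
  let ?C = "\<lambda>k. uniform_count_measure {..<m k}"
  have sp: "(\<Pi>\<^sub>E k\<in>UNIV. space (?C k)) = space \<mu>"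
    by (simp add: vilenkin_measure_def space_PiM)
  have sets: "sigma_sets (space \<mu>) (prod_algebra UNIV ?C) = sets \<mu>"
    unfolding sp[symmetric] by (simp add: vilenkin_measure_def sets_PiM)
  have "A \<in> sigma_sets (space \<mu>) (prod_algebra UNIV ?C)"
    using assms by (simp add: sets)
  with prod_algebra_sets_into_space[of UNIV ?C, unfolded sp] show ?thesis
  proof (induction rule: sigma_sets_induct_disjoint[OF Int_stable_prod_algebra, consumes 2, case_names basic empty compl union])
    case (basic A)
    then obtain J E where A: "A = prod_emb UNIV ?C J (\<Pi>\<^sub>E j\<in>J. E j)" and J: "finite J"
      by (elim prod_algebraE)
    have Aeq: "A = {x \<in> space \<mu>. \<forall>j\<in>J. x j \<in> E j}"
      unfolding A prod_emb_def by (auto simp: space_haar space_uniform_count_measure PiE_def Pi_def)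
    obtain n where n: "J \<subseteq> {..<n}"
      using J finite_nat_iff_bounded by blast
    show ?case
    proof (intro approximable_poly vilenkin_poly_finite_dependence[where n = n])
      fix x z assume *: "x \<in> A" "z \<in> space \<mu>" "\<And>k. k < n \<Longrightarrow> z k = x k"
      have "z j = x j" if "j \<in> J" for j
        using n that by (intro *(3)) auto
      then show "z \<in> A" using *(1,2) by (auto simp: Aeq)
    qed (auto simp: Aeq)
  next
    case empty
    show ?case
      by (intro approximable_poly vilenkin_poly_finite_dependence[where n = 0]) auto
  next
    case (compl A)
    then have A: "A \<in> sets \<mu>" by (simp add: sets)
    have "approximable (\<lambda>x. indicator (space \<mu>) x + (- 1) * indicator A x)"
    proof (intro approximable_add approximable_mult)
      show "approximable (indicator (space \<mu>))"
        by (intro approximable_poly vilenkin_poly_finite_dependence[where n = 0]) auto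
      show "approximable (indicator A)" by fact
      show "integrable \<mu> (indicator (space \<mu>) :: _ \<Rightarrow> complex)"
        by (intro integrable_indicator_complex) auto
      show "integrable \<mu> (\<lambda>x. (- 1) * indicator A x :: complex)"
        by (intro integrable_mult_right integrable_indicator_complex A)
    qed
    then show ?case
      by (rule approximable_cong) (auto simp: indicator_def)
  next
    case (union A)
    then have A: "A i \<in> sets \<mu>" for i by (auto simp: sets)
    have fin: "indicator (\<Union>i<k. A i) x = (\<Sum>i<k. indicator (A i) x :: complex)" for k x
      by (rule indicator_UN_disjoint[OF finite_lessThan disjoint_family_on_mono[OF subset_UNIV union(1)]])
    have "approximable (\<lambda>x. \<Sum>i<k. indicator (A i) x)" for k
    proof (induction k)
      case 0
      \<comment> \<open>The zero function is obtained as 0 times a polynomial.\<close>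
      show ?case using approximable_mult[OF approximable_poly[OF vilenkin_poly_cyl], of 0] by simp
    next
      case (Suc k)
      have "approximable (\<lambda>x. (\<Sum>i<k. indicator (A i) x) + indicator (A k) x)"
        by (intro approximable_add Bochner_Integration.integrable_sum integrable_indicator_complex A Suc union(3))
      then show ?case by simp
    qed
    moreover have "indicator (\<Union>i<k. A i) = (\<lambda>x. \<Sum>i<k. indicator (A i) x :: complex)" for k
      by (rule ext) (rule fin)
    ultimately have 1: "approximable (indicator (\<Union>i<k. A i))" for k
      by (simp only:)
    show ?case
    proof (rule approximable_limit[where s = "\<lambda>k. indicator (\<Union>i<k. A i)"])
      show "integrable \<mu> (indicator (\<Union>i<k. A i) :: _ \<Rightarrow> complex)" for k
        using A by (intro integrable_indicator_complex sets.finite_UN) auto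
      show "integrable \<mu> (indicator (\<Union>i. A i) :: _ \<Rightarrow> complex)"
        using A by (intro integrable_indicator_complex sets.countable_UN) auto
      show "(\<lambda>k. indicator (\<Union>i<k. A i) x) \<longlonglongrightarrow> (indicator (\<Union>i. A i) x :: complex)" for x
        by (rule LIMSEQ_indicator_UN)
      show "cmod (indicator (\<Union>i<k. A i) x) \<le> 2 * cmod (indicator (\<Union>i. A i) x)" for k x
        by (auto simp: indicator_def)
    qed (rule 1)
  qed
qed

lemma approximable_integrable:
  assumes "integrable \<mu> f"
  shows "approximable f"
  using assms
proof (induction rule: integrable_induct)
  case (base A c)
  have "approximable (\<lambda>x. c * indicator A x)"
    using base by (intro approximable_mult approximable_indicator)
  then show ?case
    by (rule approximable_cong) (simp add: indicator_def)
next
  case (add f g)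
  then show ?case by (intro approximable_add)
next
  case (lim f s)
  then show ?case by (intro approximable_limit[of s f])
qed

subsection \<open>Almost everywhere convergence\<close>

text \<open>\<open>f\<close> is split into a polynomial \<open>g p\<close> and a small remainder
  \<open>h p\<close>. The weak type bound controls the Fejer means of \<open>h p\<close>, Markov's
  inequality controls \<open>h p\<close> itself, and by Borel-Cantelli almost every point avoids
  both bad sets for all large \<open>p\<close>.\<close>

lemma fejer_tendsto_AE:
  assumes f: "integrable \<mu> f"
  shows "AE x in \<mu>. (\<lambda>n. vilenkin_fejer m n f x) \<longlonglongrightarrow> f x"
proof -
  let ?q = "\<lambda>p. (1/2 :: real) ^ p"
  \<comment> \<open>The error is the square of the height \<open>?q p\<close> used below: dividing
    by the height leaves \<open>?q p\<close>, which is summable.\<close>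
  have "\<exists>g. vilenkin_poly g \<and> (\<integral>x. cmod (f x - g x) \<partial>\<mu>) < ?q p * ?q p" for p
    using approximable_integrable[OF f] by (auto simp: approximable_def)
  then obtain g where g: "\<And>p. vilenkin_poly (g p)"
    and fg: "\<And>p. (\<integral>x. cmod (f x - g p x) \<partial>\<mu>) < ?q p * ?q p"
    by metis
  define h where "h p x = f x - g p x" for p x
  have gi: "integrable \<mu> (g p)" for p
    using g by (auto simp: vilenkin_poly_def)
  then have hi: "integrable \<mu> (h p)" for p
    unfolding h_def using f by auto
  then have hm [measurable]: "h p \<in> borel_measurable \<mu>" for p
    by auto
  have "\<exists>B. B \<in> sets \<mu> \<and> measure \<mu> B \<le> 9 * b / ?q p * (\<integral>y. cmod (h p y) \<partial>\<mu>) \<and>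
    (\<forall>x\<in>space \<mu> - B. \<forall>n. cmod (vilenkin_fejer m n (h p) x) \<le> 16 * real b ^ 4 * ?q p)" for p
  proof -
    have "0 < ?q p" by simp
    from weak_type_fejer[OF hi this] show ?thesis by metis
  qed
  then obtain B where B: "\<And>p. B p \<in> sets \<mu>"
      "\<And>p. measure \<mu> (B p) \<le> 9 * b / ?q p * (\<integral>y. cmod (h p y) \<partial>\<mu>)"
      "\<And>p x n. x \<in> space \<mu> - B p \<Longrightarrow> cmod (vilenkin_fejer m n (h p) x) \<le> 16 * real b ^ 4 * ?q p"
    by metis
  define C where "C p = {x \<in> space \<mu>. ?q p \<le> cmod (h p x)}" for p
  have C [measurable]: "C p \<in> sets \<mu>" for p
    unfolding C_def by measurable
  have Ih: "(\<integral>y. cmod (h p y) \<partial>\<mu>) \<le> ?q p * ?q p" for p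
    using fg[of p] by (simp add: h_def)
  have mB: "measure \<mu> (B p) \<le> 9 * b * ?q p" for p
  proof -
    have "measure \<mu> (B p) \<le> 9 * b / ?q p * (?q p * ?q p)"
      using B(2)[of p] Ih[of p] by (rule order_trans[OF _ mult_left_mono]) simp
    then show ?thesis by simp
  qed
  have mC: "measure \<mu> (C p) \<le> ?q p" for p
  proof -
    have "measure \<mu> (C p) \<le> (\<integral>y. cmod (h p y) \<partial>\<mu>) / ?q p"
      unfolding C_def using hi[of p]
      by (intro integral_Markov_inequality_measure[where A = "space \<mu>" and u = "\<lambda>x. cmod (h p x)", simplified]) auto
    also have "\<dots> \<le> (?q p * ?q p) / ?q p"
      using Ih by (intro divide_right_mono) auto
    finally show ?thesis by simp
  qed
  have "AE x in \<mu>. \<forall>\<^sub>F p in sequentially. x \<in> space \<mu> - (B p \<union> C p)"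
  proof (rule borel_cantelli_AE1)
    show "B p \<union> C p \<in> sets \<mu>" for p using B(1) by auto
    show "emeasure \<mu> (B p \<union> C p) < \<infinity>" for p
      by (simp add: less_top[symmetric])
    have "norm (measure \<mu> (B p \<union> C p)) \<le> (9 * b + 1) * ?q p" for p
    proof -
      have "measure \<mu> (B p \<union> C p) \<le> 9 * b * ?q p + ?q p"
        using measure_Un_le[OF B(1) C, of p p] mB[of p] mC[of p] by linarith
      also have "\<dots> = (9 * b + 1) * ?q p"
        by (simp only: of_nat_add of_nat_mult distrib_right of_nat_1 of_nat_numeral mult_1_left)
      finally show ?thesis
        by (simp only: real_norm_def abs_of_nonneg[OF measure_nonneg])
    qed
    moreover have "summable (\<lambda>p. (9 * b + 1) * ?q p)"
      by (intro summable_mult summable_geometric) simp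
    ultimately show "summable (\<lambda>p. measure \<mu> (B p \<union> C p))"
      by (rule summable_comparison_test'[where N = 0, rotated])
  qed
  then show ?thesis
  proof (rule AE_mp, intro AE_I2 impI)
    fix x assume x: "x \<in> space \<mu>"
      and ev: "\<forall>\<^sub>F p in sequentially. x \<in> space \<mu> - (B p \<union> C p)"
    \<comment> \<open>The first summand comes from the Fejer means of \<open>h p\<close>, the 1 from
      \<open>h p x\<close>.\<close>
    let ?K = "16 * real b ^ 4 + 1"
    show "(\<lambda>n. vilenkin_fejer m n f x) \<longlonglongrightarrow> f x"
    proof (rule tendstoI)
      fix e :: real assume e: "0 < e"
      have "(\<lambda>p. ?K * ?q p) \<longlonglongrightarrow> ?K * 0"
        by (intro tendsto_mult tendsto_const LIMSEQ_realpow_zero) auto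
      then have "\<forall>\<^sub>F p in sequentially. ?K * ?q p < e / 2"
        using e by (intro order_tendstoD) auto
      with ev have "\<forall>\<^sub>F p in sequentially. x \<in> space \<mu> - (B p \<union> C p) \<and> ?K * ?q p < e / 2"
        by eventually_elim auto
      \<comment> \<open>A single such \<open>p\<close> suffices; it is fixed before \<open>n\<close>
        tends to infinity.\<close>
      then obtain p where p: "x \<in> space \<mu> - (B p \<union> C p)" "?K * ?q p < e / 2"
        using eventually_happens sequentially_bot by blast
      have hx: "cmod (h p x) \<le> ?q p"
        using p(1) by (auto simp: C_def)
      have "\<forall>\<^sub>F n in sequentially. dist (vilenkin_fejer m n (g p) x) (g p x) < e / 2"
        using e by (intro tendstoD fejer_tendsto_poly g x) auto
      then show "\<forall>\<^sub>F n in sequentially. dist (vilenkin_fejer m n f x) (f x) < e"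
      proof eventually_elim
        case (elim n)
        have "f = (\<lambda>x. g p x + h p x)" by (simp add: h_def)
        then have "vilenkin_fejer m n f x = vilenkin_fejer m n (g p) x + vilenkin_fejer m n (h p) x"
          using fejer_add[OF gi hi, of n p p x] by simp
        then have "vilenkin_fejer m n f x - f x
            = (vilenkin_fejer m n (g p) x - g p x) + vilenkin_fejer m n (h p) x - h p x"
          by (simp add: h_def)
        then have "cmod (vilenkin_fejer m n f x - f x) \<le> cmod (vilenkin_fejer m n (g p) x - g p x)
            + cmod (vilenkin_fejer m n (h p) x) + cmod (h p x)"
          by (metis norm_triangle_ineq norm_triangle_ineq4 add_right_mono order_trans)
        also have "\<dots> < e / 2 + 16 * real b ^ 4 * ?q p + ?q p"
          using elim hx B(3)[of x p n] p(1) by (auto simp: dist_norm)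
        also have "\<dots> < e" using p(2) by (simp add: algebra_simps)
        finally show ?case by (simp add: dist_norm)
      qed
    qed
  qed
qed

end

theorem theorem5:
  fixes m :: "nat \<Rightarrow> nat" and f :: "(nat \<Rightarrow> nat) \<Rightarrow> complex"
  assumes "\<And>k. 2 \<le> m k"
    and "bdd_above (range m)"
    and "integrable (vilenkin_measure m) f"
  shows "AE x in vilenkin_measure m. (\<lambda>n. vilenkin_fejer m n f x) \<longlonglongrightarrow> f x"
proof -
  obtain b where "\<And>k. m k \<le> b"
    using assms(2) by (auto simp: bdd_above_def)
  with assms(1) interpret bounded_radix m b
    by unfold_locales
  from assms(3) show ?thesis
    by (rule fejer_tendsto_AE)
qed

end
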